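(* Let $B$ be a nilpotent $n\times n$ matrix over $\mathbb{F}$. If $n\le 3$, then $\mathcal{P}(\mathcal{N}_B)=\mathcal{P}(n)$. If $n\ge 4$, then $\mathcal{P}(\mathcal{N}_B)=\mathcal{P}(n)$ if and only if $B^2=0$.
   Context: $\mathbb{F}$ is an algebraically closed field of characteristic $0$. $\mathcal{P}(n)$ is the set of all partitions of $n$. For a nilpotent matrix $A$, $\mathrm{sh}(A)$ is the partition given by the sizes of the Jordan blocks of its Jordan canonical form. $\mathcal{N}_B$ is the set of all nilpotent $n\times n$ matrices commuting with $B$, and $\mathcal{P}(\mathcal{N}_B)=\{\mathrm{sh}(A):A\in\mathcal{N}_B\}$. Equivalently, $\mathcal{P}(\mathcal{N}_B)=\mathcal{P}(n)$ means that $\mathcal{N}_B$ meets every nilpotent conjugacy orbit. *)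

theory Defs
  imports "Jordan_Normal_Form.Jordan_Normal_Form" "HOL-Computational_Algebra.Polynomial"
begin

definition nilpotent_mat :: "nat \<Rightarrow> 'a::field mat \<Rightarrow> bool" where
  "nilpotent_mat n A \<longleftrightarrow> A \<in> carrier_mat n n \<and> (\<exists>k. A ^\<^sub>m k = 0\<^sub>m n n)"

definition commuting_nilpotents :: "nat \<Rightarrow> 'a::field mat \<Rightarrow> 'a mat set" where
  "commuting_nilpotents n B = {A. nilpotent_mat n A \<and> A * B = B * A}"

definition partitions :: "nat \<Rightarrow> nat multiset set" where
  "partitions n = {p. (\<forall>x \<in># p. 0 < x) \<and> sum_mset p = n}"

definition is_shape :: "'a::field mat \<Rightarrow> nat multiset \<Rightarrow> bool" where
  "is_shape A p \<longleftrightarrow> (\<exists>n_as. jordan_nf A n_as \<and> mset (map fst n_as) = p)"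

definition shapes_of_commuting_nilpotents :: "nat \<Rightarrow> 'a::field mat \<Rightarrow> nat multiset set" where
  "shapes_of_commuting_nilpotents n B = {p. \<exists>A \<in> commuting_nilpotents n B. is_shape A p}"

end

theory Submission
  imports Defs "Jordan_Normal_Form.Jordan_Normal_Form_Existence" "Jordan_Normal_Form.Jordan_Normal_Form_Uniqueness"
begin

text \<open>If \<open>B\<^sup>2 = 0\<close>, then \<open>B\<close> has shape \<open>(2\<^sup>k, 1\<^sup>n\<^sup>-\<^sup>2\<^sup>k)\<close>, and it suffices to find for every partition of
  \<open>n\<close> some nilpotent matrix of that shape commuting with some matrix of shape \<open>(2\<^sup>k, 1\<^sup>n\<^sup>-\<^sup>2\<^sup>k)\<close>. Taking
  direct sums, this is reduced to one block, where a power of the Jordan block does it, and to two odd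
  blocks of total size \<open>2k\<close>, where one deforms two equal blocks.

  Conversely, let \<open>B\<^sup>2 \<noteq> 0\<close>. If \<open>B\<close> commutes with a nilpotent matrix of shape \<open>(n)\<close>, it is, up to an
  invertible factor, a power of that matrix, and therefore \<open>ker B \<subseteq> im B\<close>. For \<open>n \<ge> 4\<close> this inclusion
  fails if \<open>B\<close> also commutes with a nilpotent matrix of shape \<open>(n - 1, 1)\<close>. For \<open>n = 3\<close>, \<open>B\<close> is a
  Jordan block and the first part applies with the roles of the two matrices exchanged.\<close>

section \<open>Triangularization of nilpotent matrices\<close>

lemma inverse_exists_if_trivial_kernel:
  fixes P :: "'a::field mat"
  assumes P: "P \<in> carrier_mat n n"
    and inj: "\<And>z. z \<in> carrier_vec n \<Longrightarrow> P *\<^sub>v z = 0\<^sub>v n \<Longrightarrow> z = 0\<^sub>v n"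
  obtains Q where "Q \<in> carrier_mat n n" "P * Q = 1\<^sub>m n" "Q * P = 1\<^sub>m n"
proof -
  have "det P \<noteq> 0"
    using det_0_iff_vec_prod_zero_field[OF P] inj by blast
  from det_non_zero_imp_unit[OF P this, of "()"] show thesis
    using that by (auto simp: Units_def ring_mat_def)
qed

lemma similar_mat_if_intertwined:
  fixes A J P :: "'a::field mat"
  assumes A: "A \<in> carrier_mat n n" and J: "J \<in> carrier_mat n n" and P: "P \<in> carrier_mat n n"
    and AP: "A * P = P * J"
    and inj: "\<And>z. z \<in> carrier_vec n \<Longrightarrow> P *\<^sub>v z = 0\<^sub>v n \<Longrightarrow> z = 0\<^sub>v n"
  shows "similar_mat A J"
proof -
  obtain Q where Q: "Q \<in> carrier_mat n n" "P * Q = 1\<^sub>m n" "Q * P = 1\<^sub>m n"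
    using inverse_exists_if_trivial_kernel[OF P inj] by blast
  have "P * J * Q = A * (P * Q)"
    using A P Q(1) unfolding AP[symmetric] by (simp add: assoc_mult_mat[of _ n n _ n _ n])
  then have "A = P * J * Q" using A Q by simp
  then show ?thesis
    using A J P Q by (intro similar_matI[of A J P Q n]) auto
qed

lemma similar_mat_carrier:
  assumes "similar_mat A B" "A \<in> carrier_mat n n"
  shows "B \<in> carrier_mat n n"
proof -
  obtain m where m: "A \<in> carrier_mat m m" "B \<in> carrier_mat m m"
    using similar_matD[OF assms(1)] by blast
  with carrier_matD(1)[OF assms(2)] carrier_matD(1)[OF m(1)] show ?thesis by simp
qed

lemma similar_mat_pow_eq_0:
  assumes "similar_mat A B" "A \<in> carrier_mat n n" "A ^\<^sub>m k = 0\<^sub>m n n"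
  shows "B ^\<^sub>m k = 0\<^sub>m n n"
proof -
  obtain P Q where w: "similar_mat_wit B A P Q"
    using similar_mat_sym[OF assms(1)] by (auto simp: similar_mat_def)
  from similar_mat_witD2[OF similar_mat_carrier[OF assms(1,2)] w]
    similar_mat_wit_pow_id[OF w, of k] assms(3)
  show ?thesis by auto
qed

lemma index_mult_mat_vec_sum:
  "A \<in> carrier_mat n m \<Longrightarrow> v \<in> carrier_vec m \<Longrightarrow> i < n \<Longrightarrow>
    (A *\<^sub>v v) $ i = (\<Sum>j<m. A $$ (i, j) * v $ j)"
  by (auto simp: scalar_prod_def lessThan_atLeast0 intro!: sum.cong)

lemma index_mult_mat_sum:
  "A \<in> carrier_mat n m \<Longrightarrow> B \<in> carrier_mat m l \<Longrightarrow> i < n \<Longrightarrow> j < l \<Longrightarrow>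
    (A * B) $$ (i, j) = (\<Sum>k<m. A $$ (i, k) * B $$ (k, j))"
  by (auto simp: scalar_prod_def lessThan_atLeast0 intro!: sum.cong)

text \<open>By the exchange argument \<open>v\<close> may replace a unit vector \<open>e_i\<close>
  with \<open>v $ i \<noteq> 0\<close> in the standard basis. For \<open>v\<close> in the kernel of
  a matrix, this change of basis clears the first column.\<close>

lemma first_column_completion:
  fixes v :: "'a::field vec"
  assumes v: "v \<in> carrier_vec n" "v \<noteq> 0\<^sub>v n"
  obtains P Q where "P \<in> carrier_mat n n" "Q \<in> carrier_mat n n" "P * Q = 1\<^sub>m n" "Q * P = 1\<^sub>m n"
    "col P 0 = v"
proof -
  obtain i where i: "i < n" "v $ i \<noteq> 0"
    using v by (metis carrier_vecD eq_vecI index_zero_vec)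
  \<comment> \<open>The remaining columns are the unit vectors other than the \<open>i\<close>-th one.\<close>
  define P where "P = mat n n (\<lambda>(r, c). if c = 0 then v $ r
    else if r = (if c \<le> i then c - 1 else c) then 1 else 0)"
  have P: "P \<in> carrier_mat n n" by (simp add: P_def)
  have "z = 0\<^sub>v n" if z: "z \<in> carrier_vec n" and Pz: "P *\<^sub>v z = 0\<^sub>v n" for z
  proof -
    have row: "(\<Sum>c<n. P $$ (r, c) * z $ c) = 0" if "r < n" for r
      using index_mult_mat_vec_sum[OF P z that] Pz that by simp
    \<comment> \<open>Row \<open>i\<close> meets only the first column, since \<open>e_i\<close> is
      the omitted unit vector; this isolates \<open>z $ 0\<close>.\<close>
    have "(\<Sum>c<n. P $$ (i, c) * z $ c) = (\<Sum>c<n. if c = 0 then v $ i * z $ 0 else 0)"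
      by (rule sum.cong) (use i in \<open>auto simp: P_def\<close>)
    with row[OF i(1)] i have z0: "z $ 0 = 0" by simp
    have "z $ c = 0" if c: "0 < c" "c < n" for c
    proof -
      define r where "r = (if c \<le> i then c - 1 else c)"
      have r: "r < n" using c by (auto simp: r_def)
      have "(\<Sum>c'<n. P $$ (r, c') * z $ c') = (\<Sum>c'<n. if c' = c then z $ c else 0)"
        by (rule sum.cong) (use r c i z0 in \<open>auto simp: P_def r_def\<close>)
      with row[OF r] c show ?thesis by simp
    qed
    with z0 z show ?thesis
      by (intro eq_vecI) (auto, metis gr_zeroI)
  qed
  then obtain Q where "Q \<in> carrier_mat n n" "P * Q = 1\<^sub>m n" "Q * P = 1\<^sub>m n"
    using inverse_exists_if_trivial_kernel[OF P] by blast
  moreover have "col P 0 = v"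
    using i v by (intro eq_vecI) (auto simp: P_def)
  ultimately show thesis using P that by blast
qed

lemma nilpotent_mat_kernel:
  fixes A :: "'a::field mat"
  assumes "nilpotent_mat n A" "0 < n"
  obtains v where "v \<in> carrier_vec n" "v \<noteq> 0\<^sub>v n" "A *\<^sub>v v = 0\<^sub>v n"
proof -
  from assms obtain k where A: "A \<in> carrier_mat n n" and k: "A ^\<^sub>m k = 0\<^sub>m n n"
    by (auto simp: nilpotent_mat_def)
  have "det (A ^\<^sub>m k) = det A ^ k"
    using A by (induct k) (auto simp: det_mult[of _ n])
  with k \<open>0 < n\<close> have "det A = 0" by simp
  with det_0_iff_vec_prod_zero_field[OF A] that show thesis by blast
qed

lemma nilpotent_mat_similar:
  "nilpotent_mat n A \<Longrightarrow> similar_mat A B \<Longrightarrow> nilpotent_mat n B"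
  unfolding nilpotent_mat_def using similar_mat_carrier[of A B n] similar_mat_pow_eq_0[of A B n] by blast

text \<open>A kernel vector as first basis vector clears the first column, and the lower right block
  is again nilpotent, of size one less. As 0 is the only eigenvalue, this works over every
  field.\<close>

lemma nilpotent_mat_triangularizable:
  fixes A :: "'a::field mat"
  assumes "nilpotent_mat n A"
  shows "\<exists>T. similar_mat A T \<and> upper_triangular T"
  using assms
proof (induct n arbitrary: A)
  case 0
  then have "A \<in> carrier_mat 0 0" by (simp add: nilpotent_mat_def)
  then show ?case
    by (intro exI[of _ A]) (auto intro: similar_mat_refl)
next
  case (Suc m)
  let ?n = "Suc m"
  from Suc.prems have A: "A \<in> carrier_mat ?n ?n" by (simp add: nilpotent_mat_def)
  obtain v where v: "v \<in> carrier_vec ?n" "v \<noteq> 0\<^sub>v ?n" "A *\<^sub>v v = 0\<^sub>v ?n"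
    using nilpotent_mat_kernel[OF Suc.prems] by auto
  obtain P Q where PQ: "P \<in> carrier_mat ?n ?n" "Q \<in> carrier_mat ?n ?n"
    "P * Q = 1\<^sub>m ?n" "Q * P = 1\<^sub>m ?n" "col P 0 = v"
    using first_column_completion[OF v(1,2)] by blast
  define D where "D = Q * (A * P)"
  have D: "D \<in> carrier_mat ?n ?n" using A PQ by (simp add: D_def)
  have "P * D * Q = (P * Q) * A * (P * Q)"
    using A PQ(1,2) by (simp add: D_def assoc_mult_mat[of _ ?n ?n _ ?n _ ?n])
  then have "A = P * D * Q" using A PQ by simp
  then have AD: "similar_mat A D"
    using A D PQ by (intro similar_matI[of A D P Q ?n]) auto
  have "col D 0 = Q *\<^sub>v (A *\<^sub>v v)"
    unfolding D_def col_mult2[OF PQ(2) mult_carrier_mat[OF A PQ(1)] zero_less_Suc]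
      col_mult2[OF A PQ(1) zero_less_Suc] PQ(5) ..
  also have "\<dots> = 0\<^sub>v ?n" using v PQ by (auto simp: scalar_prod_def)
  finally have c0: "D $$ (i, 0) = 0" if "i < ?n" for i
    using that D by (metis carrier_matD index_col index_zero_vec(1) zero_less_Suc)
  obtain D1 D2 D3 D4 where sp: "split_block D 1 1 = (D1, D2, D3, D4)"
    by (metis prod_cases4)
  from split_block[OF sp, of m m] D
  have Ds: "D1 \<in> carrier_mat 1 1" "D2 \<in> carrier_mat 1 m" "D3 \<in> carrier_mat m 1"
    "D4 \<in> carrier_mat m m" and DD: "D = four_block_mat D1 D2 D3 D4" by auto
  have "D1 $$ (0, 0) = 0" using c0[of 0] Ds by (simp add: DD)
  then have D1: "D1 = 0\<^sub>m 1 1" using Ds by (intro eq_matI) auto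
  have "D3 $$ (i, 0) = 0" if "i < m" for i using c0[of "Suc i"] Ds that by (simp add: DD)
  then have D3: "D3 = 0\<^sub>m m 1" using Ds by (intro eq_matI) auto
  have DB: "D = four_block_mat (0\<^sub>m 1 1) D2 (0\<^sub>m m 1) D4" using DD D1 D3 by simp
  \<comment> \<open>Block triangularity passes to powers, with \<open>D4 ^\<^sub>m k\<close> in the
    lower right. \<open>X\<close> and \<open>Y\<close> stay unspecified because only the nilpotency
    of \<open>D4\<close> is read off.\<close>
  have pow: "\<exists>X Y. X \<in> carrier_mat 1 1 \<and> Y \<in> carrier_mat 1 m \<and>
      D ^\<^sub>m k = four_block_mat X Y (0\<^sub>m m 1) (D4 ^\<^sub>m k)" for k
  proof (induct k)
    case 0
    have "D ^\<^sub>m 0 = four_block_mat (1\<^sub>m 1) (0\<^sub>m 1 m) (0\<^sub>m m 1) (D4 ^\<^sub>m 0)"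
      using D Ds by simp
    then show ?case by (metis one_carrier_mat zero_carrier_mat)
  next
    case (Suc k)
    then obtain X Y where XY: "X \<in> carrier_mat 1 1" "Y \<in> carrier_mat 1 m"
      "D ^\<^sub>m k = four_block_mat X Y (0\<^sub>m m 1) (D4 ^\<^sub>m k)" by blast
    have "D ^\<^sub>m Suc k = four_block_mat X Y (0\<^sub>m m 1) (D4 ^\<^sub>m k) *
        four_block_mat (0\<^sub>m 1 1) D2 (0\<^sub>m m 1) D4" using XY(3) DB by simp
    also have "\<dots> = four_block_mat (X * 0\<^sub>m 1 1 + Y * 0\<^sub>m m 1) (X * D2 + Y * D4)
        (0\<^sub>m m 1 * 0\<^sub>m 1 1 + D4 ^\<^sub>m k * 0\<^sub>m m 1) (0\<^sub>m m 1 * D2 + D4 ^\<^sub>m k * D4)"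
      by (rule mult_four_block_mat) (use XY Ds in auto)
    also have "0\<^sub>m m 1 * 0\<^sub>m 1 1 + D4 ^\<^sub>m k * 0\<^sub>m m 1 = 0\<^sub>m m 1" using Ds by simp
    also have "0\<^sub>m m 1 * D2 + D4 ^\<^sub>m k * D4 = D4 ^\<^sub>m Suc k"
      using Ds by (simp add: left_add_zero_mat[OF mult_carrier_mat[OF pow_carrier_mat]])
    finally show ?case using XY Ds
      by (intro exI[of _ "X * 0\<^sub>m 1 1 + Y * 0\<^sub>m m 1"] exI[of _ "X * D2 + Y * D4"]) auto
  qed
  have "nilpotent_mat ?n D" using nilpotent_mat_similar[OF Suc.prems AD] .
  then obtain k where k: "D ^\<^sub>m k = 0\<^sub>m ?n ?n" by (auto simp: nilpotent_mat_def)
  obtain X Y where XY: "X \<in> carrier_mat 1 1" "Y \<in> carrier_mat 1 m"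
      "D ^\<^sub>m k = four_block_mat X Y (0\<^sub>m m 1) (D4 ^\<^sub>m k)" using pow by blast
  have "(D4 ^\<^sub>m k) $$ (i, j) = 0" if "i < m" "j < m" for i j
  proof -
    have "(D ^\<^sub>m k) $$ (Suc i, Suc j) = (D4 ^\<^sub>m k) $$ (i, j)"
      unfolding XY(3) using XY(1,2) Ds that by simp
    then show ?thesis using that by (simp add: k)
  qed
  then have "D4 ^\<^sub>m k = 0\<^sub>m m m" using Ds by (intro eq_matI) auto
  then have "nilpotent_mat m D4" using Ds by (auto simp: nilpotent_mat_def)
  then obtain T where T: "similar_mat D4 T" "upper_triangular T" using Suc.hyps by blast
  have Tc: "T \<in> carrier_mat m m" using similar_mat_carrier[OF T(1) Ds(4)] .
  obtain B0 where B0: "similar_mat D (four_block_mat (0\<^sub>m 1 1) B0 (0\<^sub>m m 1) T)"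
    using similar_mat_four_block_0_ex[OF similar_mat_refl[OF zero_carrier_mat] T(1) Ds(2) zero_carrier_mat Ds(4)]
      DB by metis
  have "upper_triangular (four_block_mat (0\<^sub>m 1 1) B0 (0\<^sub>m m 1) T)"
    by (rule upper_triangular_four_block[OF zero_carrier_mat Tc]) (use T in auto)
  with similar_mat_trans[OF AD B0] show ?case by blast
qed

lemma nilpotent_mat_jordan_nf_exists:
  fixes A :: "'a::field mat"
  assumes "nilpotent_mat n A"
  shows "\<exists>n_as. jordan_nf A n_as"
proof -
  obtain T where T: "similar_mat A T" "upper_triangular T"
    using nilpotent_mat_triangularizable[OF assms] by blast
  then have "T \<in> carrier_mat n n"
    using similar_mat_carrier[OF T(1)] assms by (simp add: nilpotent_mat_def)
  from triangular_to_jnf_vector[OF this T(2)] T(1) show ?thesis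
    unfolding jordan_nf_def using similar_mat_trans by blast
qed

section \<open>Jordan matrices\<close>

lemma four_block_diag_eq_0_iff:
  assumes "X \<in> carrier_mat n n" "Y \<in> carrier_mat m m"
  shows "four_block_mat X (0\<^sub>m n m) (0\<^sub>m m n) Y = 0\<^sub>m (n + m) (n + m) \<longleftrightarrow>
    X = 0\<^sub>m n n \<and> Y = 0\<^sub>m m m"
proof
  assume eq: "four_block_mat X (0\<^sub>m n m) (0\<^sub>m m n) Y = 0\<^sub>m (n + m) (n + m)"
  have "X $$ (i, j) = 0" if "i < n" "j < n" for i j
    using arg_cong[OF eq, of "\<lambda>M. M $$ (i, j)"] that assms by simp
  moreover have "Y $$ (i, j) = 0" if "i < m" "j < m" for i j
    using arg_cong[OF eq, of "\<lambda>M. M $$ (n + i, n + j)"] that assms by simp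
  ultimately show "X = 0\<^sub>m n n \<and> Y = 0\<^sub>m m m" using assms by auto
qed auto

lemma jordan_block_pow_eq_0_iff:
  "jordan_block m (a :: 'a::field) ^\<^sub>m k = 0\<^sub>m m m \<longleftrightarrow> m = 0 \<or> a = 0 \<and> m \<le> k"
proof
  assume eq: "jordan_block m a ^\<^sub>m k = 0\<^sub>m m m"
  have "a = 0 \<and> m \<le> k" if m: "m \<noteq> 0"
  proof -
    \<comment> \<open>Entry (0, 0) is \<open>a ^ k\<close>, which forces \<open>a = 0\<close>; then
      entry (0, k) is 1 as long as it exists, so \<open>m \<le> k\<close>.\<close>
    have "(jordan_block m a ^\<^sub>m k) $$ (0, 0) = 0" using m unfolding eq by simp
    then have a: "a = 0" using m by (simp add: jordan_block_pow)
    have "(jordan_block m a ^\<^sub>m k) $$ (0, k) = 0" if "k < m" using m that unfolding eq by simp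
    then show ?thesis using a m by (force simp: jordan_block_zero_pow)
  qed
  then show "m = 0 \<or> a = 0 \<and> m \<le> k" by blast
next
  assume "m = 0 \<or> a = 0 \<and> m \<le> k"
  then show "jordan_block m a ^\<^sub>m k = 0\<^sub>m m m"
    by (auto simp: jordan_block_zero_pow intro!: eq_matI)
qed

text \<open>The power is taken block by block. The disjunct \<open>m = 0\<close> covers empty
  blocks, which vanish for every eigenvalue.\<close>

lemma jordan_matrix_pow_eq_0_iff:
  fixes n_as :: "(nat \<times> 'a::field) list"
  defines "n \<equiv> \<lambda>n_as :: (nat \<times> 'a) list. sum_list (map fst n_as)"
  shows "jordan_matrix n_as ^\<^sub>m k = 0\<^sub>m (n n_as) (n n_as) \<longleftrightarrow>
    (\<forall>(m, a) \<in> set n_as. m = 0 \<or> a = 0 \<and> m \<le> k)"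
proof (induct n_as)
  case Nil
  show ?case by (auto simp: n_def intro!: eq_matI)
next
  case (Cons ma n_as)
  obtain m a where ma: "ma = (m, a)" by force
  have "jordan_matrix n_as \<in> carrier_mat (n n_as) (n n_as)"
    unfolding n_def by (rule jordan_matrix_carrier)
  then show ?case
    using Cons four_block_diag_eq_0_iff[of "jordan_block m a ^\<^sub>m k" m "jordan_matrix n_as ^\<^sub>m k" "n n_as"]
    by (simp add: ma jordan_matrix_Cons pow_four_block_mat jordan_block_pow_eq_0_iff flip: n_def)
      (simp add: n_def)
qed

section \<open>Reordering the blocks of a Jordan matrix\<close>

lemma similar_mat_diag_swap:
  fixes A B :: "'a::field mat"
  assumes A: "A \<in> carrier_mat n n" and B: "B \<in> carrier_mat m m"
  shows "similar_mat (four_block_mat A (0\<^sub>m n m) (0\<^sub>m m n) B) (four_block_mat B (0\<^sub>m m n) (0\<^sub>m n m) A)"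
proof -
  define P :: "'a mat" where "P = four_block_mat (0\<^sub>m n m) (1\<^sub>m n) (1\<^sub>m m) (0\<^sub>m m n)"
  define Q :: "'a mat" where "Q = four_block_mat (0\<^sub>m m n) (1\<^sub>m m) (1\<^sub>m n) (0\<^sub>m n m)"
  let ?AB = "four_block_mat A (0\<^sub>m n m) (0\<^sub>m m n) B"
  let ?BA = "four_block_mat B (0\<^sub>m m n) (0\<^sub>m n m) A"
  have P: "P \<in> carrier_mat (n + m) (n + m)" and Q: "Q \<in> carrier_mat (n + m) (n + m)"
    by (auto simp: P_def Q_def)
  have PQ: "P * Q = 1\<^sub>m (n + m)"
    unfolding P_def Q_def
    by (subst mult_four_block_mat[of _ n m _ n _ m _ _ n _ m]) auto
  have QP: "Q * P = 1\<^sub>m (n + m)" by (rule mat_mult_left_right_inverse[OF P Q PQ])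
  have "P * ?BA * Q = ?AB"
    unfolding P_def Q_def
    apply (subst mult_four_block_mat[of _ n m _ n _ m _ _ m _ n], use A B in simp_all)
    apply (subst mult_four_block_mat[of _ n m _ n _ m _ _ n _ m], use A B in simp_all)
    done
  then show ?thesis
    using A B P Q PQ QP by (intro similar_matI[of _ _ P Q "n + m"]) auto
qed

lemma jordan_matrix_swap:
  "similar_mat (jordan_matrix (x # y # zs)) (jordan_matrix (y # x # zs) :: 'a::field mat)"
proof -
  obtain m a l b where xy: "x = (m, a)" "y = (l, b)" by force
  define X Y R where XYR: "X = jordan_block m a" "Y = jordan_block l b" "R = jordan_matrix zs"
  define r where "r = sum_list (map fst zs)"
  have X: "X \<in> carrier_mat m m" and Y: "Y \<in> carrier_mat l l" and R: "R \<in> carrier_mat r r"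
    by (simp_all add: XYR r_def)
  have xyz: "jordan_matrix (x # y # zs) = four_block_mat
      (four_block_mat X (0\<^sub>m m l) (0\<^sub>m l m) Y) (0\<^sub>m (m + l) r) (0\<^sub>m r (m + l)) R"
    using assoc_four_block_mat[of X Y R] X Y R
    by (simp add: xy jordan_matrix_Cons flip: XYR r_def)
  have yxz: "jordan_matrix (y # x # zs) = four_block_mat
      (four_block_mat Y (0\<^sub>m l m) (0\<^sub>m m l) X) (0\<^sub>m (m + l) r) (0\<^sub>m r (m + l)) R"
    using assoc_four_block_mat[of Y X R] X Y R
    by (simp add: xy jordan_matrix_Cons add.commute flip: XYR r_def)
  show ?thesis
    unfolding xyz yxz
    by (rule similar_mat_four_block_0_0[OF similar_mat_diag_swap[OF X Y] similar_mat_refl[OF R] _ R])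
      (use X Y in simp)
qed

lemma jordan_matrix_Cons_similar:
  assumes "similar_mat (jordan_matrix xs) (jordan_matrix ys :: 'a::field mat)"
  shows "similar_mat (jordan_matrix (x # xs)) (jordan_matrix (x # ys))"
proof -
  have d: "sum_list (map fst xs) = sum_list (map fst ys)"
    using similar_mat_carrier[OF assms jordan_matrix_carrier]
    by (metis carrier_matD(1) jordan_matrix_dim(1))
  obtain m a where x: "x = (m, a)" by force
  show ?thesis
    unfolding x jordan_matrix_Cons d
    by (rule similar_mat_four_block_0_0[OF similar_mat_refl assms])
      (auto simp flip: d)
qed

lemma jordan_matrix_move_front:
  "similar_mat (jordan_matrix (us @ x # vs)) (jordan_matrix (x # us @ vs) :: 'a::field mat)"
proof (induct us)
  case Nil
  show ?case by (auto intro: similar_mat_refl[OF jordan_matrix_carrier])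
next
  case (Cons u us)
  from similar_mat_trans[OF jordan_matrix_Cons_similar[OF Cons] jordan_matrix_swap]
  show ?case by simp
qed

text \<open>Adjacent swaps bring the head of one list to the front of the other, and induction
  treats the tails. This is why a shape can be a multiset although \<open>jordan_nf\<close> works
  with lists.\<close>

lemma jordan_matrix_mset_cong:
  "mset xs = mset ys \<Longrightarrow> similar_mat (jordan_matrix xs) (jordan_matrix ys :: 'a::field mat)"
proof (induct xs arbitrary: ys)
  case Nil
  then show ?case by (auto intro: similar_mat_refl[OF jordan_matrix_carrier])
next
  case (Cons x xs)
  then have "x \<in> set ys" by (metis list.set_intros(1) mset_eq_setD)
  then obtain us vs where ys: "ys = us @ x # vs" by (metis split_list)
  with Cons.prems have "mset xs = mset (us @ vs)" by simp
  from jordan_matrix_Cons_similar[OF Cons.hyps[OF this]] show ?case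
    unfolding ys by (rule similar_mat_trans[OF _ similar_mat_sym[OF jordan_matrix_move_front]])
qed

text \<open>The superdiagonal is interrupted in column \<open>a\<close>, where the second block
  begins.\<close>

lemma jordan_matrix_two_blocks_index:
  assumes "i < a + b" "c < a + b"
  shows "jordan_matrix [(a, 0), (b, 0)] $$ (i, c) = (if c = Suc i \<and> c \<noteq> a then 1 else 0 :: 'a::field)"
proof -
  have "jordan_matrix [(a, 0), (b, 0 :: 'a)] =
      four_block_mat (jordan_block a 0) (0\<^sub>m a b) (0\<^sub>m b a) (jordan_block b 0)"
    by (simp add: jordan_matrix_def Let_def del: diag_block_mat.simps(2))
      (simp add: diag_block_mat.simps(2)[of _ "[_]"] Let_def del: diag_block_mat.simps(2))
  with assms show ?thesis by auto
qed

text \<open>Counting from 0, the odd columns are the second columns of the blocks.\<close>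

lemma jordan_matrix_replicate_2_index:
  "i < 2 * m \<Longrightarrow> c < 2 * m \<Longrightarrow>
    jordan_matrix (replicate m (2, 0)) $$ (i, c) = (if odd c \<and> c = Suc i then 1 else 0 :: 'a::field)"
proof (induct m arbitrary: i c)
  case (Suc m)
  have d: "sum_list (map fst (replicate m (2 :: nat, 0 :: 'a))) = 2 * m"
    by (simp add: sum_list_replicate)
  have J: "jordan_matrix (replicate m (2, 0 :: 'a)) \<in> carrier_mat (2 * m) (2 * m)"
    using jordan_matrix_carrier[of "replicate m (2, 0 :: 'a)"] unfolding d .
  have "jordan_matrix (replicate (Suc m) (2, 0 :: 'a)) $$ (i, c) =
    (if i < 2 then if c < 2 then jordan_block 2 0 $$ (i, c) else 0
     else if c < 2 then 0 else jordan_matrix (replicate m (2, 0)) $$ (i - 2, c - 2))"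
    using Suc.prems carrier_matD[OF J] unfolding replicate_Suc jordan_matrix_Cons d
    by (subst index_mat_four_block(1)) auto
  also have "\<dots> = (if odd c \<and> c = Suc i then 1 else 0)"
  proof (cases "i < 2 \<or> c < 2")
    case True
    then show ?thesis by (auto elim: oddE)
  next
    case False
    then show ?thesis
      using Suc.prems Suc.hyps[of "i - 2" "c - 2"] by auto
  qed
  finally show ?case .
qed simp

section \<open>Shapes of nilpotent matrices\<close>

lemma partition_part_le:
  assumes "p \<in> partitions n" "m \<in># p"
  shows "m \<le> n"
proof -
  obtain p' where "p = add_mset m p'" using multi_member_split[OF assms(2)] by blast
  with assms(1) show ?thesis by (auto simp: partitions_def)
qed

lemma partition_eq_single:
  assumes "p \<in> partitions n" "n \<in># p"
  shows "p = {#n#}"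
proof -
  obtain p' where p: "p = add_mset n p'" using assms(2) by (metis mset_add)
  with assms(1) have "\<forall>x \<in># p'. 0 < x" "sum_mset p' = 0" by (auto simp: partitions_def)
  then have "p' = {#}" by (cases p') auto
  with p show ?thesis by simp
qed

text \<open>These are the possible shapes of square-zero matrices; such a shape is determined by the
  single number \<open>k\<close>.\<close>

lemma partition_parts_le_2:
  assumes p: "p \<in> partitions n" and le: "\<forall>m \<in># p. m \<le> 2"
  obtains k where "2 * k \<le> n" "p = replicate_mset k 2 + replicate_mset (n - 2 * k) 1"
proof -
  define k l where "k = count p 2" and "l = count p 1"
  have m: "m = 1 \<or> m = 2" if "m \<in># p" for m
    using le p that by (force simp: partitions_def)
  have "p = replicate_mset k 2 + replicate_mset l 1"
  proof (rule multiset_eqI)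
    fix x
    show "count p x = count (replicate_mset k 2 + replicate_mset l 1) x"
      using m[of x] by (cases "x \<in># p") (auto simp: k_def l_def not_in_iff)
  qed
  moreover from this p have "2 * k + l = n" by (simp add: partitions_def)
  then have "2 * k \<le> n" "l = n - 2 * k" by linarith+
  ultimately show thesis using that by blast
qed

text \<open>For nilpotent matrices this is \<^const>\<open>is_shape\<close>, with the zero eigenvalues made explicit.\<close>

definition nil_shape :: "'a::field mat \<Rightarrow> nat multiset \<Rightarrow> bool" where
  "nil_shape A p \<longleftrightarrow> (\<exists>xs. jordan_nf A (map (\<lambda>m. (m, 0)) xs) \<and> mset xs = p)"

lemma nil_shape_jordan_nf:
  assumes "nil_shape A (mset xs)"
  shows "jordan_nf A (map (\<lambda>m. (m, 0)) xs)"
proof -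
  obtain ys where ys: "jordan_nf A (map (\<lambda>m. (m, 0)) ys)" "mset ys = mset xs"
    using assms by (auto simp: nil_shape_def)
  have "similar_mat (jordan_matrix (map (\<lambda>m. (m, 0)) ys)) (jordan_matrix (map (\<lambda>m. (m, 0 :: 'a)) xs))"
    by (rule jordan_matrix_mset_cong) (simp add: ys)
  with ys mset_eq_setD[OF ys(2)] show ?thesis
    by (auto simp: jordan_nf_def intro: similar_mat_trans)
qed

lemma nil_shape_similar:
  assumes "nil_shape A p" "similar_mat A B"
  shows "nil_shape B p"
proof -
  obtain xs where xs: "jordan_nf A (map (\<lambda>m. (m, 0)) xs)" "mset xs = p"
    using assms(1) by (auto simp: nil_shape_def)
  then have "similar_mat A (jordan_matrix (map (\<lambda>m. (m, 0)) xs))" by (simp add: jordan_nf_def)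
  from similar_mat_trans[OF similar_mat_sym[OF assms(2)] this]
  have "jordan_nf B (map (\<lambda>m. (m, 0)) xs)" using xs(1) by (simp add: jordan_nf_def)
  with xs(2) show ?thesis by (auto simp: nil_shape_def)
qed

lemma nil_shape_imp_similar:
  assumes "nil_shape A p" "nil_shape B p"
  shows "similar_mat A B"
proof -
  obtain xs where "p = mset xs" by (metis ex_mset)
  with nil_shape_jordan_nf[of A xs] nil_shape_jordan_nf[of B xs] assms show ?thesis
    using similar_mat_trans[OF _ similar_mat_sym, of A _ B] by (auto simp: jordan_nf_def)
qed

lemma nil_shape_partition:
  assumes "nil_shape A p" "A \<in> carrier_mat n n"
  shows "p \<in> partitions n"
proof -
  obtain xs where xs: "jordan_nf A (map (\<lambda>m. (m, 0)) xs)" "mset xs = p"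
    using assms by (auto simp: nil_shape_def)
  then have "similar_mat A (jordan_matrix (map (\<lambda>m. (m, 0)) xs))" by (simp add: jordan_nf_def)
  from carrier_matD(1)[OF similar_mat_carrier[OF this assms(2)]] have "sum_list xs = n"
    by (simp add: comp_def)
  moreover have "\<forall>m \<in> set xs. 0 < m" using xs by (force simp: jordan_nf_def)
  ultimately show ?thesis
    by (simp add: partitions_def sum_mset_sum_list flip: xs(2))
qed

text \<open>The case \<open>k = 2\<close> recognizes square-zero matrices by their shape, and
  \<open>k = n\<close> yields nilpotency.\<close>

lemma nil_shape_pow_eq_0_iff:
  fixes A :: "'a::field mat"
  assumes "nil_shape A p" and A: "A \<in> carrier_mat n n"
  shows "A ^\<^sub>m k = 0\<^sub>m n n \<longleftrightarrow> (\<forall>m \<in># p. m \<le> k)"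
proof -
  obtain xs where xs: "jordan_nf A (map (\<lambda>m. (m, 0)) xs)" "mset xs = p"
    using assms by (auto simp: nil_shape_def)
  let ?J = "jordan_matrix (map (\<lambda>m. (m, 0)) xs) :: 'a mat"
  have sim: "similar_mat A ?J" using xs by (simp add: jordan_nf_def)
  have J: "?J \<in> carrier_mat n n" using similar_mat_carrier[OF sim A] .
  have "A ^\<^sub>m k = 0\<^sub>m n n \<longleftrightarrow> ?J ^\<^sub>m k = 0\<^sub>m n n"
    using similar_mat_pow_eq_0[OF sim A] similar_mat_pow_eq_0[OF similar_mat_sym[OF sim] J] by blast
  also have "\<dots> \<longleftrightarrow> (\<forall>(m, a) \<in> set (map (\<lambda>m. (m, 0 :: 'a)) xs). m = 0 \<or> a = 0 \<and> m \<le> k)"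
    using jordan_matrix_pow_eq_0_iff[of "map (\<lambda>m. (m, 0 :: 'a)) xs" k] carrier_matD(1)[OF J]
    by simp
  finally show ?thesis using xs by auto
qed

lemma nil_shape_nilpotent:
  assumes "nil_shape A p" "A \<in> carrier_mat n n"
  shows "nilpotent_mat n A"
proof -
  have "\<forall>m \<in># p. m \<le> n"
    using partition_part_le[OF nil_shape_partition[OF assms]] by blast
  with nil_shape_pow_eq_0_iff[OF assms] assms(2) show ?thesis
    by (auto simp: nilpotent_mat_def)
qed

text \<open>A vanishing power of \<open>A\<close> forces eigenvalue 0 in every Jordan block, since
  blocks are nonempty.\<close>

lemma is_shape_iff_nil_shape:
  fixes A :: "'a::field mat"
  assumes "nilpotent_mat n A"
  shows "is_shape A p \<longleftrightarrow> nil_shape A p"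
proof
  assume "is_shape A p"
  then obtain n_as where nf: "jordan_nf A n_as" and p: "mset (map fst n_as) = p"
    by (auto simp: is_shape_def)
  obtain k where A: "A \<in> carrier_mat n n" and k: "A ^\<^sub>m k = 0\<^sub>m n n"
    using assms by (auto simp: nilpotent_mat_def)
  have sim: "similar_mat A (jordan_matrix n_as)" using nf by (simp add: jordan_nf_def)
  have "sum_list (map fst n_as) = n"
    using similar_mat_carrier[OF sim A] by (metis carrier_matD(1) jordan_matrix_dim(1))
  with similar_mat_pow_eq_0[OF sim A k] jordan_matrix_pow_eq_0_iff[of n_as k] nf
  have "\<forall>(m, a) \<in> set n_as. a = 0" by (force simp: jordan_nf_def)
  then have "map (\<lambda>m. (m, 0)) (map fst n_as) = n_as"
    by (auto intro!: map_idI)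
  with nf p show "nil_shape A p" by (metis nil_shape_def)
next
  assume "nil_shape A p"
  then obtain xs where "jordan_nf A (map (\<lambda>m. (m, 0)) xs)" "mset xs = p"
    by (auto simp: nil_shape_def)
  then show "is_shape A p"
    by (intro is_shape_def[THEN iffD2] exI[of _ "map (\<lambda>m. (m, 0)) xs"]) (simp add: comp_def)
qed

lemma nil_shape_exists:
  assumes "nilpotent_mat n A"
  obtains p where "nil_shape A p"
proof -
  obtain n_as where "jordan_nf A n_as" using nilpotent_mat_jordan_nf_exists[OF assms] by blast
  then have "is_shape A (mset (map fst n_as))" by (auto simp: is_shape_def)
  with is_shape_iff_nil_shape[OF assms] that show thesis by blast
qed

lemma nil_shape_diag:
  assumes "nil_shape A p" "nil_shape B q"
    and A: "A \<in> carrier_mat n n" and B: "B \<in> carrier_mat m m"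
  shows "nil_shape (four_block_mat A (0\<^sub>m n m) (0\<^sub>m m n) B) (p + q)"
proof -
  obtain xs ys where xs: "jordan_nf A (map (\<lambda>m. (m, 0)) xs)" "mset xs = p"
    and ys: "jordan_nf B (map (\<lambda>m. (m, 0)) ys)" "mset ys = q"
    using assms by (auto simp: nil_shape_def)
  have "four_block_mat A (0\<^sub>m n m) (0\<^sub>m m n) B = diag_block_mat [A, B]"
    using A B by (auto simp: Let_def intro!: eq_matI)
  with jordan_nf_diag_block_mat[of "[(A, map (\<lambda>m. (m, 0)) xs), (B, map (\<lambda>m. (m, 0)) ys)]"] xs ys
  show ?thesis
    by (intro nil_shape_def[THEN iffD2] exI[of _ "xs @ ys"]) auto
qed

lemma nil_shape_jordan_matrix:
  assumes "0 \<notin> set xs"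
  shows "nil_shape (jordan_matrix (map (\<lambda>m. (m, 0 :: 'a::field)) xs)) (mset xs)"
proof -
  have "jordan_nf (jordan_matrix (map (\<lambda>m. (m, 0 :: 'a)) xs)) (map (\<lambda>m. (m, 0)) xs)"
    unfolding jordan_nf_def using similar_mat_refl[OF jordan_matrix_carrier] assms by auto
  then show ?thesis unfolding nil_shape_def by blast
qed

text \<open>Each Jordan block contributes one dimension to the kernel.\<close>

lemma size_nil_shape:
  fixes B :: "'a::field mat"
  assumes "nil_shape B q" and B: "B \<in> carrier_mat n n"
  shows "size q = kernel_dim B"
proof -
  obtain xs where xs: "jordan_nf B (map (\<lambda>m. (m, 0)) xs)" "mset xs = q"
    using assms by (auto simp: nil_shape_def)
  have "char_matrix B 0 ^\<^sub>m 1 = B"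
    using B by (auto simp: char_matrix_def intro!: eq_matI)
  then have "kernel_dim B = dim_gen_eigenspace B 0 1"
    by (simp add: dim_gen_eigenspace_def)
  also have "\<dots> = (\<Sum>m\<leftarrow>xs. min 1 m)"
    unfolding dim_gen_eigenspace[OF xs(1)] by (simp add: filter_map comp_def)
  also have "\<dots> = (\<Sum>m\<leftarrow>xs. 1)"
    using xs(1) by (intro arg_cong[of _ _ sum_list] map_cong) (auto simp: jordan_nf_def image_image Suc_le_eq intro!: min_absorb1 gr0I)
  finally show ?thesis using xs(2) by (auto simp: sum_list_triv)
qed

section \<open>Commuting pairs of shapes\<close>

lemma mult_mat_vec_unit_vec:
  fixes A :: "'a::semiring_1 mat"
  assumes "A \<in> carrier_mat n m" "c < m"
  shows "A *\<^sub>v unit_vec m c = col A c"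
proof (rule eq_vecI)
  fix i assume "i < dim_vec (col A c)"
  then have i: "i < n" using assms by simp
  have "(A *\<^sub>v unit_vec m c) $ i = row A i \<bullet> unit_vec m c" using assms i by simp
  also have "\<dots> = row A i $ c" by (rule scalar_prod_right_unit[OF assms(2)])
  finally show "(A *\<^sub>v unit_vec m c) $ i = col A c $ i" using assms i by simp
qed (use assms in simp)

text \<open>A nonzero kernel of \<open>P\<close> would be invariant under the nilpotent \<open>J\<close>, hence meet the kernel
  of \<open>J\<close>.\<close>

lemma similar_mat_if_intertwined_nilpotent:
  fixes A J P :: "'a::field mat"
  assumes A: "A \<in> carrier_mat n n" and J: "J \<in> carrier_mat n n" and P: "P \<in> carrier_mat n n"
    and AP: "A * P = P * J" and nil: "J ^\<^sub>m k = 0\<^sub>m n n"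
    and inj: "\<And>z. z \<in> carrier_vec n \<Longrightarrow> J *\<^sub>v z = 0\<^sub>v n \<Longrightarrow> P *\<^sub>v z = 0\<^sub>v n \<Longrightarrow> z = 0\<^sub>v n"
  shows "similar_mat A J"
proof (rule similar_mat_if_intertwined[OF A J P AP])
  have "z = 0\<^sub>v n" if "z \<in> carrier_vec n" "J ^\<^sub>m t *\<^sub>v z = 0\<^sub>v n" "P *\<^sub>v z = 0\<^sub>v n" for t z
    using that
  proof (induct t arbitrary: z)
    case 0
    then show ?case using J by simp
  next
    case (Suc t)
    have "P *\<^sub>v (J *\<^sub>v z) = A *\<^sub>v (P *\<^sub>v z)"
      using A J P Suc.prems(1) by (metis AP assoc_mult_mat_vec)
    also have "\<dots> = 0\<^sub>v n" using A Suc.prems(3) by auto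
    finally have "P *\<^sub>v (J *\<^sub>v z) = 0\<^sub>v n" .
    moreover have "J ^\<^sub>m t *\<^sub>v (J *\<^sub>v z) = 0\<^sub>v n"
      using Suc.prems J by (simp add: assoc_mult_mat_vec[of _ n n _ n])
    ultimately have "J *\<^sub>v z = 0\<^sub>v n"
      using Suc.hyps[of "J *\<^sub>v z"] J Suc.prems(1) by simp
    with Suc.prems inj show ?case by blast
  qed
  moreover have "J ^\<^sub>m k *\<^sub>v z = 0\<^sub>v n" if "z \<in> carrier_vec n" for z
    using that by (auto simp: nil)
  ultimately show "\<And>z. z \<in> carrier_vec n \<Longrightarrow> P *\<^sub>v z = 0\<^sub>v n \<Longrightarrow> z = 0\<^sub>v n" by blast
qed

text \<open>The two chains form the columns of an intertwining matrix \<open>P\<close>. By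
  \<open>similar_mat_if_intertwined_nilpotent\<close> its injectivity need only be tested on the
  kernel of the Jordan matrix, so independence of the chain ends \<open>u 0\<close> and
  \<open>v 0\<close> suffices.\<close>

lemma nil_shape_two_chains:
  fixes A :: "'a::field mat"
  assumes A: "A \<in> carrier_mat n n" and n: "n = a + b" and pos: "0 < a" "0 < b"
    and u: "\<And>c. c < a \<Longrightarrow> u c \<in> carrier_vec n" and v: "\<And>c. c < b \<Longrightarrow> v c \<in> carrier_vec n"
    and u0: "A *\<^sub>v u 0 = 0\<^sub>v n" and uS: "\<And>c. Suc c < a \<Longrightarrow> A *\<^sub>v u (Suc c) = u c"
    and v0: "A *\<^sub>v v 0 = 0\<^sub>v n" and vS: "\<And>c. Suc c < b \<Longrightarrow> A *\<^sub>v v (Suc c) = v c"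
    and indep: "\<And>x y. (\<And>i. i < n \<Longrightarrow> u 0 $ i * x + v 0 $ i * y = 0) \<Longrightarrow> x = 0 \<and> y = 0"
  shows "nil_shape A {#a, b#}"
proof -
  let ?J = "jordan_matrix [(a, 0), (b, 0)] :: 'a mat"
  define w where "w c = (if c < a then u c else v (c - a))" for c
  have w: "w c \<in> carrier_vec n" if "c < n" for c using that u v by (auto simp: w_def n)
  define P where "P = mat n n (\<lambda>(i, c). w c $ i)"
  have P: "P \<in> carrier_mat n n" by (simp add: P_def)
  have colP: "col P c = w c" if "c < n" for c
    using w[OF that] that by (intro eq_vecI) (auto simp: P_def)
  have J: "?J \<in> carrier_mat n n" using jordan_matrix_carrier[of "[(a, 0), (b, 0)]"] by (simp add: n)
  have colJ: "col ?J c = (if c = 0 \<or> c = a then 0\<^sub>v n else unit_vec n (c - 1))" if "c < n" for c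
    using that J by (intro eq_vecI) (auto simp: n jordan_matrix_two_blocks_index unit_vec_def)
  have "A * P = P * ?J"
  proof (rule mat_col_eqI)
    fix c assume "c < dim_col (P * ?J)"
    then have c: "c < n" by (simp add: n)
    have "A *\<^sub>v w c = P *\<^sub>v col ?J c"
    proof (cases "c = 0 \<or> c = a")
      case True
      then show ?thesis using u0 v0 pos P c by (auto simp: colJ w_def)
    next
      case False
      then have "A *\<^sub>v w c = w (c - 1)"
        using uS[of "c - 1"] vS[of "c - a - 1"] c by (auto simp: w_def n Suc_diff_Suc)
      also have "\<dots> = P *\<^sub>v col ?J c"
        using False c P by (simp add: colJ mult_mat_vec_unit_vec[of _ n n] colP)
      finally show ?thesis .
    qed
    then show "col (A * P) c = col (P * ?J) c"
      unfolding col_mult2[OF A P c] col_mult2[OF P J c] colP[OF c] .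
  qed (use A J P in auto)
  moreover have "?J ^\<^sub>m n = 0\<^sub>m n n"
    using jordan_matrix_pow_eq_0_iff[of "[(a, 0), (b, 0 :: 'a)]" n] by (simp add: n)
  moreover have "z = 0\<^sub>v n" if z: "z \<in> carrier_vec n" and Jz: "?J *\<^sub>v z = 0\<^sub>v n" and Pz: "P *\<^sub>v z = 0\<^sub>v n" for z
  proof -
    \<comment> \<open>Row \<open>c - 1\<close> of \<open>J z = 0\<close> reads off
      \<open>z $ c\<close>, except at the two positions where a block begins.\<close>
    have z0: "z $ c = 0" if c: "c < n" "c \<noteq> 0" "c \<noteq> a" for c
    proof -
      have "(?J *\<^sub>v z) $ (c - 1) = (\<Sum>j<n. ?J $$ (c - 1, j) * z $ j)"
        using c by (intro index_mult_mat_vec_sum[OF J z]) auto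
      also have "\<dots> = (\<Sum>j<n. if j = c then z $ c else 0)"
        by (rule sum.cong) (use c in \<open>auto simp: jordan_matrix_two_blocks_index n\<close>)
      finally show ?thesis using Jz c by simp
    qed
    have "u 0 $ i * z $ 0 + v 0 $ i * z $ a = 0" if i: "i < n" for i
    proof -
      have "(P *\<^sub>v z) $ i = (\<Sum>c<n. P $$ (i, c) * z $ c)"
        by (rule index_mult_mat_vec_sum[OF P z i])
      also have "\<dots> = (\<Sum>c\<in>{0, a}. P $$ (i, c) * z $ c)"
        by (rule sum.mono_neutral_right) (use pos z0 in \<open>auto simp: n\<close>)
      also have "\<dots> = u 0 $ i * z $ 0 + v 0 $ i * z $ a"
        using pos i by (simp add: P_def w_def n)
      finally show ?thesis using Pz i by simp
    qed
    then have "z $ 0 = 0 \<and> z $ a = 0" by (rule indep)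
    with z0 have "z $ i = 0" if "i < n" for i using that by metis
    then show "z = 0\<^sub>v n" using z by (intro eq_vecI) auto
  qed
  ultimately have "similar_mat A ?J" using similar_mat_if_intertwined_nilpotent[OF A J P] by blast
  then show ?thesis
    using pos unfolding nil_shape_def by (intro exI[of _ "[a, b]"]) (simp add: jordan_nf_def)
qed

text \<open>Shapes do not mention the field, so it enters as a type argument. As a relation between
  shapes, with the matrices bound, commutation can be assembled by direct sums.\<close>

definition commuting_shapes :: "'a::field itself \<Rightarrow> nat multiset \<Rightarrow> nat multiset \<Rightarrow> bool" where
  "commuting_shapes _ p q \<longleftrightarrow> (\<exists>n (A :: 'a mat) B. A \<in> carrier_mat n n \<and> B \<in> carrier_mat n n \<and>
    A * B = B * A \<and> nil_shape A p \<and> nil_shape B q)"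

lemma commuting_shapesI:
  fixes A :: "'a::field mat"
  assumes "A \<in> carrier_mat n n" "B \<in> carrier_mat n n" "A * B = B * A" "nil_shape A p" "nil_shape B q"
  shows "commuting_shapes TYPE('a) p q"
  unfolding commuting_shapes_def
  by (intro exI[of _ n] exI[of _ A] exI[of _ B] conjI assms)

lemma commuting_shapes_sym:
  assumes "commuting_shapes TYPE('a::field) p q"
  shows "commuting_shapes TYPE('a) q p"
proof -
  obtain n and A B :: "'a mat" where "A \<in> carrier_mat n n" "B \<in> carrier_mat n n"
    "A * B = B * A" "nil_shape A p" "nil_shape B q"
    using assms by (auto simp: commuting_shapes_def)
  then show ?thesis by (intro commuting_shapesI[of B n A]) simp_all
qed

lemma commuting_shapes_empty: "commuting_shapes TYPE('a::field) {#} {#}"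
proof -
  have "jordan_matrix [] \<in> carrier_mat 0 0" using jordan_matrix_carrier[of "[]"] by simp
  moreover have "nil_shape (jordan_matrix [] :: 'a mat) {#}"
    using nil_shape_jordan_matrix[of "[]", where 'a = 'a] by simp
  ultimately show ?thesis using commuting_shapesI by blast
qed

lemma commuting_shapes_add:
  assumes "commuting_shapes TYPE('a::field) p q" "commuting_shapes TYPE('a) p' q'"
  shows "commuting_shapes TYPE('a) (p + p') (q + q')"
proof -
  obtain n and A B :: "'a mat" where AB: "A \<in> carrier_mat n n" "B \<in> carrier_mat n n"
    "A * B = B * A" "nil_shape A p" "nil_shape B q"
    using assms(1) by (auto simp: commuting_shapes_def)
  obtain m and C D :: "'a mat" where CD: "C \<in> carrier_mat m m" "D \<in> carrier_mat m m"
    "C * D = D * C" "nil_shape C p'" "nil_shape D q'"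
    using assms(2) by (auto simp: commuting_shapes_def)
  let ?FB = "\<lambda>X Y. four_block_mat X (0\<^sub>m n m) (0\<^sub>m m n) Y"
  have mult: "?FB X Y * ?FB X' Y' = ?FB (X * X') (Y * Y')"
    if "X \<in> carrier_mat n n" "X' \<in> carrier_mat n n" "Y \<in> carrier_mat m m" "Y' \<in> carrier_mat m m"
    for X Y X' Y' :: "'a mat"
    using that by (subst mult_four_block_mat[of _ n n _ m _ m _ _ n _ m]) auto
  show ?thesis
    using AB CD
    by (intro commuting_shapesI[of "?FB A C" "n + m" "?FB B D"]) (auto simp: mult intro: nil_shape_diag)
qed

text \<open>For the Jordan block \<open>J\<close> of size \<open>a\<close>, the power
  \<open>J^(a-k)\<close> has square zero because \<open>2 * (a - k) \<ge> a\<close>. Its kernel has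
  dimension \<open>a - k\<close>, so its shape has \<open>a - k\<close> parts, each at most 2 and of
  total \<open>a\<close>: exactly \<open>k\<close> of them are 2.\<close>

lemma commuting_shapes_single:
  assumes "2 * k \<le> a" "0 < a"
  shows "commuting_shapes TYPE('a::field) {#a#} (replicate_mset k 2 + replicate_mset (a - 2 * k) 1)"
proof -
  let ?A = "jordan_block a (0 :: 'a)"
  define r where "r = a - k"
  let ?B = "?A ^\<^sub>m r"
  have A: "?A \<in> carrier_mat a a" and B: "?B \<in> carrier_mat a a" by auto
  have shA: "nil_shape ?A {#a#}"
    using nil_shape_jordan_matrix[of "[a]", where 'a = 'a] assms
    by (simp add: jordan_matrix_def del: diag_block_mat.simps)
  have "?B * ?B = 0\<^sub>m a a"
  proof (rule eq_matI)
    fix i j assume "i < dim_row (0\<^sub>m a a)" "j < dim_col (0\<^sub>m a a)"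
    then have ij: "i < a" "j < a" by auto
    show "(?B * ?B) $$ (i, j) = 0\<^sub>m a a $$ (i, j)"
      unfolding index_mult_mat_sum[OF B B ij]
      using ij assms by (auto simp: jordan_block_zero_pow r_def intro!: sum.neutral)
  qed auto
  then have B2: "?B ^\<^sub>m 2 = 0\<^sub>m a a" using B by (simp add: numeral_2_eq_2)
  then have nB: "nilpotent_mat a ?B" using B by (auto simp: nilpotent_mat_def)
  then obtain q where q: "nil_shape ?B q" by (rule nil_shape_exists)
  have part: "q \<in> partitions a" by (rule nil_shape_partition[OF q B])
  obtain k' where k': "2 * k' \<le> a" and qk: "q = replicate_mset k' 2 + replicate_mset (a - 2 * k') 1"
    using partition_parts_le_2[OF part] nil_shape_pow_eq_0_iff[OF q B, of 2] B2 by blast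
  have "size q = r"
    unfolding size_nil_shape[OF q B] using dim_kernel_zero_jordan_block_pow[of a r, where 'a = 'a] assms
    by (simp add: kernel_dim_def r_def)
  then have "k' = k" using assms k' by (simp add: qk r_def)
  moreover have "?A * ?B = ?B * ?A"
    by (induct r) (auto simp: assoc_mult_mat[of _ a a _ a _ a, symmetric])
  ultimately show ?thesis
    using commuting_shapesI[OF A B _ shA q] qk by simp
qed

text \<open>Over \<open>F[x,y]/(y\<^sup>2)\<close>, the cyclic module with the relation \<open>x^m = y x^j\<close> has dimension \<open>2m\<close>;
  \<open>y\<close> acts with shape \<open>2^m\<close>, and \<open>x\<close> has the generators \<open>1\<close> of order \<open>2m - j\<close> and
  \<open>y - x^(m - j)\<close> of order \<open>j\<close>. The basis vector with index \<open>2c\<close> is \<open>y x^(m-1-c)\<close>, the one with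
  index \<open>2c + 1\<close> is \<open>x^(m-1-c)\<close>.\<close>

lemma commuting_shapes_pair:
  assumes j: "0 < j" "j \<le> m"
  shows "commuting_shapes TYPE('a::field) {#2 * m - j, j#} (replicate_mset m 2)"
proof -
  define n where "n = 2 * m"
  define B :: "'a mat" where "B = jordan_matrix (replicate m (2, 0))"
  \<comment> \<open>This is multiplication by \<open>x\<close>. It lowers indices by 2, except that
    index 1, which is \<open>x^(m-1)\<close>, goes to \<open>x^m = y x^j\<close>, of index
    \<open>2 * (m - 1 - j)\<close>; for \<open>j = m\<close> this product is 0, as
    \<open>y x^m = y^2 x^j = 0\<close>.\<close>
  define A where "A = mat n n (\<lambda>(i, c). if c = i + 2 \<or> c = 1 \<and> j < m \<and> i = 2 * (m - 1 - j) then 1 else 0 :: 'a)"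
  have A: "A \<in> carrier_mat n n" by (simp add: A_def)
  have B: "B \<in> carrier_mat n n"
    using jordan_matrix_carrier[of "replicate m (2, 0 :: 'a)"] by (simp add: B_def n_def sum_list_replicate mult.commute)
  have Bi: "B $$ (i, c) = (if odd c \<and> c = Suc i then 1 else 0)" if "i < n" "c < n" for i c
    using that jordan_matrix_replicate_2_index[of i m c] by (simp add: B_def n_def)
  have AB: "A * B = B * A"
  proof (rule eq_matI)
    fix i c assume "i < dim_row (B * A)" "c < dim_col (B * A)"
    then have ic: "i < n" "c < n" using A B by auto
    have "(A * B) $$ (i, c) = (\<Sum>k<n. A $$ (i, k) * B $$ (k, c))"
      by (rule index_mult_mat_sum[OF A B ic])
    also have "\<dots> = (\<Sum>k<n. if k = c - 1 then if odd c then A $$ (i, k) else 0 else 0)"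
      by (rule sum.cong) (use ic in \<open>auto simp: Bi\<close>)
    also have "\<dots> = (if odd c then A $$ (i, c - 1) else 0)"
      using less_imp_diff_less[OF ic(2), of 1] by simp
    \<comment> \<open>The exceptional entry of \<open>A\<close> lies in column 1 and in an even row.
      It is met neither in column \<open>c - 1\<close> with \<open>c\<close> odd nor in row
      \<open>Suc i\<close> with \<open>i\<close> even, so both sides only see
      \<open>c = i + 3\<close>.\<close>
    also have "\<dots> = (if even i then A $$ (Suc i, c) else 0)"
    proof -
      have "A $$ (i, c - 1) = (if c = i + 3 then 1 else 0)" if "odd c"
      proof -
        from that have "c - 1 \<noteq> 1" "c - 1 = i + 2 \<longleftrightarrow> c = i + 3" by presburger+
        with ic show ?thesis by (simp add: A_def)
      qed
      moreover have "A $$ (Suc i, c) = (if c = i + 3 then 1 else 0)" if "even i"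
      proof -
        from that ic have "Suc i < n" "Suc i \<noteq> 2 * (m - 1 - j)" unfolding n_def by presburger+
        with ic show ?thesis by (simp add: A_def)
      qed
      moreover have "c = i + 3 \<Longrightarrow> odd c \<longleftrightarrow> even i" by simp
      ultimately show ?thesis by (smt (verit))
    qed
    also have "\<dots> = (\<Sum>k<n. if k = Suc i then if even i then A $$ (k, c) else 0 else 0)"
      using ic by (auto simp: n_def elim!: evenE)
    also have "\<dots> = (\<Sum>k<n. B $$ (i, k) * A $$ (k, c))"
      by (rule sum.cong) (use ic in \<open>auto simp: Bi\<close>)
    also have "\<dots> = (B * A) $$ (i, c)"
      by (rule index_mult_mat_sum[OF B A ic, symmetric])
    finally show "(A * B) $$ (i, c) = (B * A) $$ (i, c)" .
  qed (use A B in auto)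
  define \<tau> where "\<tau> c = (if c = 1 \<and> j < m then 2 * (m - 1 - j) else c - 2)" for c
  have colA: "A *\<^sub>v unit_vec n c = (if c = 0 \<or> c = 1 \<and> j = m then 0\<^sub>v n else unit_vec n (\<tau> c))"
    if "c < n" for c
    unfolding mult_mat_vec_unit_vec[OF A that]
    using that j by (intro eq_vecI) (auto simp: A_def \<tau>_def n_def)
  \<comment> \<open>\<open>u c\<close> is \<open>x^(2m-1-j-c)\<close>, the chain of the generator 1
    read from its end; exponents from \<open>m\<close> on are rewritten by
    \<open>x^m = y x^j\<close>, which gives the even indices.\<close>
  define \<sigma> where "\<sigma> c = (if c < m - j then 2 * c else 2 * (c - (m - j)) + 1)" for c
  define u where "u c = (unit_vec n (\<sigma> c) :: 'a vec)" for c
  \<comment> \<open>\<open>v d\<close> is \<open>x^(j-1-d)\<close> times the second generator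
    \<open>y - x^(m-j)\<close>.\<close>
  define v where "v d = (unit_vec n (2 * (m - j + d)) - unit_vec n (2 * d + 1) :: 'a vec)" for d
  have Av: "A *\<^sub>v v d = A *\<^sub>v unit_vec n (2 * (m - j + d)) - A *\<^sub>v unit_vec n (2 * d + 1)" for d
    unfolding v_def by (rule mult_minus_distrib_mat_vec[OF A]) auto
  have "nil_shape A {#2 * m - j, j#}"
  proof (rule nil_shape_two_chains[OF A, of _ _ u v])
    show "A *\<^sub>v u 0 = 0\<^sub>v n"
    proof -
      have "\<sigma> 0 < n" "\<sigma> 0 = 0 \<or> \<sigma> 0 = 1 \<and> j = m" using j by (auto simp: \<sigma>_def n_def)
      then show ?thesis unfolding u_def by (subst colA) auto
    qed
    show "A *\<^sub>v u (Suc c) = u c" if "Suc c < 2 * m - j" for c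
    proof -
      have "\<sigma> (Suc c) < n" using that j by (auto simp: \<sigma>_def n_def)
      moreover have "\<tau> (\<sigma> (Suc c)) = \<sigma> c" "\<sigma> (Suc c) \<noteq> 0" "j = m \<Longrightarrow> \<sigma> (Suc c) \<noteq> 1"
        using that j by (auto simp: \<sigma>_def \<tau>_def)
      ultimately show ?thesis by (auto simp: u_def colA)
    qed
    show "A *\<^sub>v v 0 = 0\<^sub>v n"
    proof -
      have "2 * (m - j) < n" "1 < n" using j by (auto simp: n_def)
      moreover have "2 * (m - 1 - j) = 2 * (m - j) - 2" by simp
      ultimately show ?thesis unfolding Av using j by (simp add: colA \<tau>_def)
    qed
    show "A *\<^sub>v v (Suc d) = v d" if "Suc d < j" for d
    proof -
      have "2 * (m - j + Suc d) < n" "2 * Suc d + 1 < n" using that j by (auto simp: n_def)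
      then show ?thesis unfolding Av by (simp add: colA \<tau>_def v_def)
    qed
    show "x = 0 \<and> y = 0" if *: "\<And>i. i < n \<Longrightarrow> u 0 $ i * x + v 0 $ i * y = 0" for x y
    proof -
      \<comment> \<open>At coordinate \<open>2 * (m - j)\<close> the vector \<open>v 0\<close> has
        entry 1 and \<open>u 0\<close> has entry 0.\<close>
      have "2 * (m - j) < n" using j by (auto simp: n_def)
      from *[OF this] this have "y = 0" using j
        by (auto simp: u_def v_def \<sigma>_def n_def split: if_splits)
      moreover have "\<sigma> 0 < n" using j by (auto simp: \<sigma>_def n_def)
      ultimately show ?thesis using *[of "\<sigma> 0"] by (simp add: u_def)
    qed
  qed (use j in \<open>auto simp: n_def u_def v_def \<sigma>_def\<close>)
  moreover have "nil_shape B (replicate_mset m 2)"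
    using nil_shape_jordan_matrix[of "replicate m 2", where 'a = 'a] by (simp add: B_def map_replicate)
  ultimately show ?thesis using commuting_shapesI[OF A B AB] by blast
qed

lemma replicate_mset_add: "replicate_mset (k + l) x = replicate_mset k x + replicate_mset l x"
  by (induct k) auto

text \<open>One part \<open>a\<close> is split off; it can carry up to \<open>a div 2\<close> of the
  parts 2, and induction handles the rest. This fails only if \<open>a\<close> and the rest are both
  odd and all parts of the second shape are 2. Then the rest has an odd part too, and
  \<open>commuting_shapes_pair\<close> treats both at once.\<close>

lemma commuting_shapes_square_zero:
  assumes "p \<in> partitions n" "2 * k \<le> n"
  shows "commuting_shapes TYPE('a::field) p (replicate_mset k 2 + replicate_mset (n - 2 * k) 1)"
  using assms
proof (induct "size p" arbitrary: p n k rule: less_induct)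
  case less
  show ?case
  proof (cases "p = {#}")
    case True
    with less.prems show ?thesis by (simp add: partitions_def commuting_shapes_empty)
  next
    case False
    then obtain a p' where p: "p = add_mset a p'" by (metis multiset_cases)
    define n' where "n' = sum_mset p'"
    have a: "0 < a" and n: "n = a + n'" and p': "p' \<in> partitions n'"
      using less.prems(1) by (auto simp: partitions_def p n'_def)
    show ?thesis
    proof (cases "k \<le> a div 2 + n' div 2")
      case True
      define k1 where "k1 = min k (a div 2)"
      define k2 where "k2 = k - k1"
      have k: "2 * k1 \<le> a" "2 * k2 \<le> n'" "k = k1 + k2"
        using True by (auto simp: k1_def k2_def)
      have "commuting_shapes TYPE('a) ({#a#} + p')
        ((replicate_mset k1 2 + replicate_mset (a - 2 * k1) 1) +
         (replicate_mset k2 2 + replicate_mset (n' - 2 * k2) 1))"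
        by (intro commuting_shapes_add commuting_shapes_single less.hyps) (use k a p' in \<open>auto simp: p\<close>)
      moreover have "n - 2 * k = (a - 2 * k1) + (n' - 2 * k2)" using k n by simp
      then have "replicate_mset (n - 2 * k) (1 :: nat) =
          replicate_mset (a - 2 * k1) 1 + replicate_mset (n' - 2 * k2) 1"
        by (simp only: replicate_mset_add)
      moreover have "replicate_mset k (2 :: nat) = replicate_mset k1 2 + replicate_mset k2 2"
        by (simp only: k(3) replicate_mset_add)
      ultimately show ?thesis by (simp add: p ac_simps)
    next
      \<comment> \<open>Only \<open>n = 2k\<close> remains, where two odd parts are treated together.\<close>
      case False
      with less.prems(2) n have odd: "odd a" "odd n'" and k: "2 * k = a + n'" by presburger+
      have "\<exists>b \<in># p'. odd b"
      proof (rule ccontr)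
        assume "\<not> (\<exists>b \<in># p'. odd b)"
        then have "even (sum_mset p')" by (induct p') auto
        with odd(2) show False by (simp add: n'_def)
      qed
      then obtain b p'' where p'': "p' = add_mset b p''" and b: "odd b" by (metis mset_add)
      define n'' where "n'' = sum_mset p''"
      have pn: "0 < b" "n' = b + n''" "p'' \<in> partitions n''"
        using p' by (auto simp: partitions_def p'' n''_def)
      obtain m where m: "a + b = 2 * m" using odd b by (metis evenE odd_even_add)
      have k2: "2 * (k - m) = n''" "k = m + (k - m)" using k pn(2) m by simp_all
      have "commuting_shapes TYPE('a) {#a, b#} (replicate_mset m 2)"
      \<comment> \<open>The smaller of the two parts plays the role of \<open>j\<close> in
        \<open>commuting_shapes_pair\<close>.\<close>
      proof (cases "b \<le> a")
        case True
        then have "2 * m - b = a" "b \<le> m" using m by simp_all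
        with commuting_shapes_pair[of b m, where 'a = 'a] pn(1) show ?thesis by simp
      next
        case False
        then have "2 * m - a = b" "a \<le> m" using m by simp_all
        with commuting_shapes_pair[of a m, where 'a = 'a] a show ?thesis by (simp add: add_mset_commute)
      qed
      moreover have "commuting_shapes TYPE('a) p''
          (replicate_mset (k - m) 2 + replicate_mset (n'' - 2 * (k - m)) 1)"
        by (rule less.hyps) (use pn k2 in \<open>auto simp: p p''\<close>)
      ultimately have "commuting_shapes TYPE('a) ({#a, b#} + p'')
          (replicate_mset m 2 + replicate_mset (k - m) 2)"
        using k2(1) by (auto dest: commuting_shapes_add)
      moreover have "replicate_mset k (2 :: nat) = replicate_mset m 2 + replicate_mset (k - m) 2"
        by (subst k2(2)) (rule replicate_mset_add)
      ultimately show ?thesis using k n by (simp add: p p'')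
    qed
  qed
qed

text \<open>Matrices of equal shape are similar, and the conjugation that takes \<open>B'\<close> to
  \<open>B\<close> takes \<open>A'\<close> to a matrix commuting with \<open>B\<close>.\<close>

lemma commuting_shapes_imp_shape:
  fixes B :: "'a::field mat"
  assumes B: "B \<in> carrier_mat n n" "nil_shape B q" and "commuting_shapes TYPE('a) p q"
  shows "p \<in> shapes_of_commuting_nilpotents n B"
proof -
  obtain m and A' B' :: "'a mat" where AB: "A' \<in> carrier_mat m m" "B' \<in> carrier_mat m m"
    "A' * B' = B' * A'" "nil_shape A' p" "nil_shape B' q"
    using assms(3) by (auto simp: commuting_shapes_def)
  have sim: "similar_mat B B'" by (rule nil_shape_imp_similar[OF B(2) AB(5)])
  from similar_mat_carrier[OF this B(1)] AB(2) have [simp]: "m = n" by auto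
  obtain P Q where "similar_mat_wit B B' P Q" using sim by (auto simp: similar_mat_def)
  from similar_mat_witD2[OF B(1) this]
  have PQ: "P * Q = 1\<^sub>m n" "Q * P = 1\<^sub>m n" "B = P * B' * Q" "P \<in> carrier_mat n n" "Q \<in> carrier_mat n n"
    by auto
  have A': "A' \<in> carrier_mat n n" and B': "B' \<in> carrier_mat n n" using AB by auto
  define A where "A = P * A' * Q"
  have A: "A \<in> carrier_mat n n" using A' PQ by (simp add: A_def)
  have prod: "(P * X * Q) * (P * Y * Q) = P * (X * Y) * Q"
    if X: "X \<in> carrier_mat n n" and Y: "Y \<in> carrier_mat n n" for X Y
  proof -
    have "(P * X * Q) * (P * Y * Q) = P * X * (Q * P) * Y * Q"
      using X Y PQ(4,5) by (simp add: assoc_mult_mat[of _ n n _ n _ n])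
    also have "\<dots> = P * (X * Y) * Q"
      using X Y PQ(4,5) by (simp add: PQ(2) assoc_mult_mat[of _ n n _ n _ n])
    finally show ?thesis .
  qed
  have "A * B = B * A"
    unfolding A_def PQ(3) prod[OF A' B'] prod[OF B' A'] using AB(3) by simp
  moreover have "similar_mat A A'"
    using A A' PQ by (intro similar_matI[of A A' P Q n]) (auto simp: A_def)
  then have "nil_shape A p" using nil_shape_similar[OF AB(4) similar_mat_sym] by blast
  then have "nilpotent_mat n A" "is_shape A p"
    using nil_shape_nilpotent[OF _ A] is_shape_iff_nil_shape[of n A p] by blast+
  ultimately show ?thesis
    unfolding shapes_of_commuting_nilpotents_def commuting_nilpotents_def by blast
qed

section \<open>Square-zero matrices commute with every shape\<close>

lemma shapes_subset_partitions:
  fixes B :: "'a::field mat"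
  shows
  "shapes_of_commuting_nilpotents n B \<subseteq> partitions n"
proof
  fix p assume "p \<in> shapes_of_commuting_nilpotents n B"
  then obtain A :: "'a mat" where A: "nilpotent_mat n A" "is_shape A p"
    by (auto simp: shapes_of_commuting_nilpotents_def commuting_nilpotents_def)
  with is_shape_iff_nil_shape[OF A(1)] nil_shape_partition[of A p n] show "p \<in> partitions n"
    by (simp add: nilpotent_mat_def)
qed

lemma shapes_if_square_zero:
  fixes B :: "'a::field mat"
  assumes B: "B \<in> carrier_mat n n" and B2: "B * B = 0\<^sub>m n n"
  shows "shapes_of_commuting_nilpotents n B = partitions n"
proof (rule antisym[OF shapes_subset_partitions], rule subsetI)
  fix p assume p: "p \<in> partitions n"
  have pow: "B ^\<^sub>m 2 = 0\<^sub>m n n" using B B2 by (simp add: numeral_2_eq_2)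
  then have "nilpotent_mat n B" using B by (auto simp: nilpotent_mat_def)
  then obtain q where q: "nil_shape B q" by (rule nil_shape_exists)
  have part: "q \<in> partitions n" by (rule nil_shape_partition[OF q B])
  obtain k where "2 * k \<le> n" and qk: "q = replicate_mset k 2 + replicate_mset (n - 2 * k) 1"
    using partition_parts_le_2[OF part] nil_shape_pow_eq_0_iff[OF q B, of 2] pow by blast
  with commuting_shapes_square_zero[OF p, where 'a = 'a] qk
  show "p \<in> shapes_of_commuting_nilpotents n B"
    by (intro commuting_shapes_imp_shape[OF B q]) simp
qed

section \<open>Commuting with shapes \<open>(n)\<close> and \<open>(n - 1, 1)\<close>\<close>

text \<open>For nilpotent \<open>B\<close> this says that no Jordan block has size 1. Being
  invariant under similarity, it carries information between bases adapted to different commuting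
  matrices.\<close>

definition kernel_in_image :: "nat \<Rightarrow> 'a::field mat \<Rightarrow> bool" where
  "kernel_in_image n B \<longleftrightarrow> (\<forall>z \<in> carrier_vec n. B *\<^sub>v z = 0\<^sub>v n \<longrightarrow> (\<exists>y \<in> carrier_vec n. z = B *\<^sub>v y))"

lemma kernel_in_image_similar:
  fixes B :: "'a::field mat"
  assumes B: "B \<in> carrier_mat n n" and sim: "similar_mat B B'" and ker: "kernel_in_image n B'"
  shows "kernel_in_image n B"
proof -
  obtain P Q where w: "similar_mat_wit B B' P Q" using sim by (auto simp: similar_mat_def)
  from similar_mat_witD2[OF B w]
  have PQ: "P * Q = 1\<^sub>m n" "Q * P = 1\<^sub>m n" "B = P * B' * Q" "B' \<in> carrier_mat n n"
    "P \<in> carrier_mat n n" "Q \<in> carrier_mat n n" by auto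
  show ?thesis
    unfolding kernel_in_image_def
  proof (intro ballI impI)
    fix z :: "'a vec" assume z: "z \<in> carrier_vec n" and Bz: "B *\<^sub>v z = 0\<^sub>v n"
    have "Q * B = (Q * P) * B' * Q"
      unfolding PQ(3) using PQ(4-6) by (simp add: assoc_mult_mat[of _ n n _ n _ n])
    then have "Q * B = B' * Q" using PQ(2,4) by simp
    with assoc_mult_mat_vec[OF PQ(4,6) z] assoc_mult_mat_vec[OF PQ(6) B z]
    have "B' *\<^sub>v (Q *\<^sub>v z) = Q *\<^sub>v (B *\<^sub>v z)" by simp
    also have "\<dots> = 0\<^sub>v n" unfolding Bz using PQ(6) by auto
    finally have "B' *\<^sub>v (Q *\<^sub>v z) = 0\<^sub>v n" .
    moreover have "Q *\<^sub>v z \<in> carrier_vec n" using z PQ(6) by simp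
    ultimately obtain y where y: "y \<in> carrier_vec n" "Q *\<^sub>v z = B' *\<^sub>v y"
      using ker unfolding kernel_in_image_def by blast
    have BP: "B * P = P * B'"
      unfolding PQ(3) using PQ(2,4-6) by (simp add: assoc_mult_mat[of _ n n _ n _ n])
    have "z = (P * Q) *\<^sub>v z" using z PQ(1) by simp
    also have "\<dots> = P *\<^sub>v (B' *\<^sub>v y)"
      unfolding assoc_mult_mat_vec[OF PQ(5,6) z] y(2) ..
    also have "\<dots> = (B * P) *\<^sub>v y"
      unfolding BP by (rule assoc_mult_mat_vec[OF PQ(5,4) y(1), symmetric])
    also have "\<dots> = B *\<^sub>v (P *\<^sub>v y)"
      by (rule assoc_mult_mat_vec[OF B PQ(5) y(1)])
    finally show "\<exists>y \<in> carrier_vec n. z = B *\<^sub>v y"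
      using y(1) PQ(5) by (intro bexI[of _ "P *\<^sub>v y"]) auto
  qed
qed

lemma commuting_transfer:
  fixes A B :: "'a::field mat"
  assumes A: "A \<in> carrier_mat n n" and B: "B \<in> carrier_mat n n" and AB: "A * B = B * A"
    and sim: "similar_mat A J"
  obtains B' where "B' \<in> carrier_mat n n" "similar_mat B B'" "J * B' = B' * J"
proof -
  obtain P Q where w: "similar_mat_wit A J P Q" using sim by (auto simp: similar_mat_def)
  from similar_mat_witD2[OF A w]
  have PQ: "P * Q = 1\<^sub>m n" "Q * P = 1\<^sub>m n" "A = P * J * Q" "J \<in> carrier_mat n n"
    "P \<in> carrier_mat n n" "Q \<in> carrier_mat n n" by auto
  define B' where "B' = Q * B * P"
  have B': "B' \<in> carrier_mat n n" using B PQ by (simp add: B'_def)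
  have "P * B' * Q = (P * Q) * B * (P * Q)"
    unfolding B'_def using B PQ(5,6) by (simp add: assoc_mult_mat[of _ n n _ n _ n])
  then have "similar_mat B B'"
    using B B' PQ by (intro similar_matI[of B B' P Q n]) auto
  moreover have J: "J = Q * A * P"
  proof -
    have "Q * A * P = (Q * P) * J * (Q * P)"
      unfolding PQ(3) using PQ(4-6) by (simp add: assoc_mult_mat[of _ n n _ n _ n])
    then show ?thesis using PQ by simp
  qed
  have prod: "(Q * X * P) * (Q * Y * P) = Q * (X * Y) * P"
    if X: "X \<in> carrier_mat n n" and Y: "Y \<in> carrier_mat n n" for X Y
  proof -
    have "(Q * X * P) * (Q * Y * P) = Q * X * (P * Q) * Y * P"
      using X Y PQ(5,6) by (simp add: assoc_mult_mat[of _ n n _ n _ n])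
    also have "\<dots> = Q * (X * Y) * P"
      using X Y PQ(5,6) by (simp add: PQ(1) assoc_mult_mat[of _ n n _ n _ n])
    finally show ?thesis .
  qed
  have "J * B' = B' * J"
    unfolding B'_def J prod[OF A B] prod[OF B A] AB ..
  ultimately show thesis using that B' by blast
qed

text \<open>The hypothesis is what commuting with a nilpotent Jordan block says entrywise; going
  back to row 0 follows a diagonal.\<close>

lemma toeplitz_if_shift:
  fixes b :: "nat \<Rightarrow> nat \<Rightarrow> 'a::zero"
  assumes "\<And>i c. Suc i < N \<Longrightarrow> c < N \<Longrightarrow> b (Suc i) c = (if c = 0 then 0 else b i (c - 1))"
  shows "i < N \<Longrightarrow> c < N \<Longrightarrow> b i c = (if i \<le> c then b 0 (c - i) else 0)"
proof (induct i arbitrary: c)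
  case (Suc i)
  then show ?case using assms[of i c] by (auto simp: Suc_le_eq Suc_diff_Suc)
qed simp

text \<open>Here \<open>B = J\<^sup>m U\<close> with \<open>U\<close> invertible and, as \<open>B\<^sup>2 \<noteq> 0\<close>, \<open>2 m < n\<close>; so the kernel of \<open>B\<close>,
  which is that of \<open>J\<^sup>m\<close>, lies in the image of \<open>J\<^sup>m\<close>.\<close>

lemma kernel_in_image_if_commutes_jordan_block:
  fixes B :: "'a::field mat"
  assumes B: "B \<in> carrier_mat n n" and comm: "jordan_block n 0 * B = B * jordan_block n 0"
    and B2: "B * B \<noteq> 0\<^sub>m n n"
  shows "kernel_in_image n B"
proof -
  let ?J = "jordan_block n (0 :: 'a)"
  have J: "?J \<in> carrier_mat n n" by simp
  have shift: "B $$ (Suc i, c) = (if c = 0 then 0 else B $$ (i, c - 1))" if ic: "Suc i < n" "c < n" for i c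
  proof -
    have i: "i < n" using ic by simp
    have "(?J * B) $$ (i, c) = (\<Sum>k<n. if k = Suc i then B $$ (k, c) else 0)"
      unfolding index_mult_mat_sum[OF J B i ic(2)]
      by (rule sum.cong) (use ic in auto)
    also have "\<dots> = B $$ (Suc i, c)" using ic by simp
    finally have 1: "(?J * B) $$ (i, c) = B $$ (Suc i, c)" .
    have "(B * ?J) $$ (i, c) = (\<Sum>k<n. if k = c - 1 then if c = 0 then 0 else B $$ (i, k) else 0)"
      unfolding index_mult_mat_sum[OF B J i ic(2)]
      by (rule sum.cong) (use ic in auto)
    also have "\<dots> = (if c = 0 then 0 else B $$ (i, c - 1))" using ic by auto
    finally show ?thesis using 1 comm by simp
  qed
  \<comment> \<open>The default 0 beyond the first row also fills those entries of \<open>U\<close>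
    below that \<open>B\<close> does not determine.\<close>
  define p where "p k = (if k < n then B $$ (0, k) else 0)" for k
  have Bp: "B $$ (i, c) = (if i \<le> c then p (c - i) else 0)" if "i < n" "c < n" for i c
    using toeplitz_if_shift[of n "\<lambda>i c. B $$ (i, c)" i c] shift that by (auto simp: p_def)
  have "\<exists>k. p k \<noteq> 0"
  proof (rule ccontr)
    assume "\<nexists>k. p k \<noteq> 0"
    then have "B = 0\<^sub>m n n" using B Bp by (intro eq_matI) auto
    with B2 show False by simp
  qed
  define m where "m = (LEAST k. p k \<noteq> 0)"
  have pm: "p m \<noteq> 0" unfolding m_def by (rule LeastI_ex) fact
  have pl: "p k = 0" if "k < m" for k using not_less_Least that unfolding m_def by blast
  \<comment> \<open>If \<open>n \<le> 2 * m\<close>, the two diagonals in a summand of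
    \<open>B * B\<close> have offsets adding up to less than \<open>2 * m\<close>, so one of them is
    below \<open>m\<close> and vanishes.\<close>
  have mn: "2 * m < n"
  proof (rule ccontr)
    assume *: "\<not> 2 * m < n"
    have "B * B = 0\<^sub>m n n"
    proof (rule eq_matI)
      fix i c assume "i < dim_row (0\<^sub>m n n)" "c < dim_col (0\<^sub>m n n)"
      then have ic: "i < n" "c < n" by auto
      have "B $$ (i, k) * B $$ (k, c) = 0" if "k < n" for k
      proof (cases "k - i < m")
        case True
        then show ?thesis using ic that by (simp add: Bp pl)
      next
        case False
        then have "c - k < m \<or> c < k" using ic that * by linarith
        then show ?thesis using ic that by (auto simp: Bp pl)
      qed
      then have "(\<Sum>k<n. B $$ (i, k) * B $$ (k, c)) = 0" by (intro sum.neutral) auto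
      then show "(B * B) $$ (i, c) = 0\<^sub>m n n $$ (i, c)"
        unfolding index_mult_mat_sum[OF B B ic] using ic by simp
    qed (use B in auto)
    with B2 show False ..
  qed
  define S where "S = ?J ^\<^sub>m m"
  have S: "S \<in> carrier_mat n n" by (simp add: S_def)
  have Si: "S $$ (i, c) = (if c = i + m then 1 else 0)" if "i < n" "c < n" for i c
    using that by (auto simp: S_def jordan_block_zero_pow)
  \<comment> \<open>Removing the first \<open>m\<close> zero diagonals leaves an upper triangular
    Toeplitz matrix with diagonal entry \<open>p m \<noteq> 0\<close>.\<close>
  define U where "U = mat n n (\<lambda>(i, c). if i \<le> c then p (m + (c - i)) else 0)"
  have U: "U \<in> carrier_mat n n" by (simp add: U_def)
  have BSU: "B = S * U"
  proof (rule eq_matI)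
    fix i c assume "i < dim_row (S * U)" "c < dim_col (S * U)"
    then have ic: "i < n" "c < n" using S U by auto
    have "(S * U) $$ (i, c) = (\<Sum>k<n. if k = i + m then U $$ (k, c) else 0)"
      unfolding index_mult_mat_sum[OF S U ic] by (rule sum.cong) (use ic in \<open>auto simp: Si\<close>)
    also have "\<dots> = (if i + m < n then U $$ (i + m, c) else 0)" by simp
    also have "\<dots> = B $$ (i, c)" using ic by (auto simp: U_def Bp pl)
    finally show "B $$ (i, c) = (S * U) $$ (i, c)" ..
  qed (use B S U in auto)
  have BUS: "B = U * S"
  proof (rule eq_matI)
    fix i c assume "i < dim_row (U * S)" "c < dim_col (U * S)"
    then have ic: "i < n" "c < n" using S U by auto
    have "(U * S) $$ (i, c) = (\<Sum>k<n. if k = c - m then if m \<le> c then U $$ (i, k) else 0 else 0)"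
      unfolding index_mult_mat_sum[OF U S ic] by (rule sum.cong) (use ic in \<open>auto simp: Si\<close>)
    also have "\<dots> = (if m \<le> c then U $$ (i, c - m) else 0)" using ic by auto
    also have "\<dots> = B $$ (i, c)" using ic by (auto simp: U_def Bp pl)
    finally show "B $$ (i, c) = (U * S) $$ (i, c)" ..
  qed (use B S U in auto)
  have "det U \<noteq> 0"
    using upper_triangular_imp_det_eq_0_iff[OF U] pm
    by (auto simp: U_def upper_triangular_def diag_mat_def)
  then have "\<And>x. x \<in> carrier_vec n \<Longrightarrow> U *\<^sub>v x = 0\<^sub>v n \<Longrightarrow> x = 0\<^sub>v n"
    using det_0_iff_vec_prod_zero_field[OF U] by blast
  then obtain V where V: "V \<in> carrier_mat n n" "U * V = 1\<^sub>m n" "V * U = 1\<^sub>m n"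
    by (rule inverse_exists_if_trivial_kernel[OF U])
  show ?thesis
    unfolding kernel_in_image_def
  proof (intro ballI impI)
    fix z :: "'a vec" assume z: "z \<in> carrier_vec n" and Bz: "B *\<^sub>v z = 0\<^sub>v n"
    have Sv: "(S *\<^sub>v x) $ i = (if i + m < n then x $ (i + m) else 0)" if x: "x \<in> carrier_vec n" and i: "i < n" for x i
    proof -
      have "(S *\<^sub>v x) $ i = (\<Sum>k<n. if k = i + m then x $ k else 0)"
        unfolding index_mult_mat_vec_sum[OF S x i] by (rule sum.cong) (use i in \<open>auto simp: Si\<close>)
      then show ?thesis by simp
    qed
    have Szc: "S *\<^sub>v z \<in> carrier_vec n" using S z by simp
    have "S *\<^sub>v z = (V * U) *\<^sub>v (S *\<^sub>v z)" using Szc V(3) by simp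
    also have "\<dots> = V *\<^sub>v (U *\<^sub>v (S *\<^sub>v z))" by (rule assoc_mult_mat_vec[OF V(1) U Szc])
    also have "U *\<^sub>v (S *\<^sub>v z) = B *\<^sub>v z"
      unfolding BUS by (rule assoc_mult_mat_vec[OF U S z, symmetric])
    also have "V *\<^sub>v (B *\<^sub>v z) = 0\<^sub>v n" unfolding Bz using V by auto
    finally have Sz: "S *\<^sub>v z = 0\<^sub>v n" .
    have z0: "z $ i = 0" if "m \<le> i" "i < n" for i
      using Sv[OF z, of "i - m"] Sz that by simp
    \<comment> \<open>\<open>x\<close> is \<open>z\<close> moved down by \<open>m\<close> places.
      Since \<open>z\<close> vanishes from place \<open>m\<close> on and \<open>2 * m < n\<close>,
      no nonzero entry is lost.\<close>
    define x where "x = vec n (\<lambda>i. if m \<le> i then z $ (i - m) else 0)"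
    have x: "x \<in> carrier_vec n" by (simp add: x_def)
    have "S *\<^sub>v x = z"
    proof (rule eq_vecI)
      fix i assume "i < dim_vec z"
      then have i: "i < n" using z by simp
      show "(S *\<^sub>v x) $ i = z $ i"
        unfolding Sv[OF x i] using i mn z0[of i] by (auto simp: x_def)
    qed (use S z in auto)
    moreover have "B *\<^sub>v (V *\<^sub>v x) = S *\<^sub>v x"
    proof -
      have "B *\<^sub>v (V *\<^sub>v x) = (B * V) *\<^sub>v x"
        by (rule assoc_mult_mat_vec[OF B V(1) x, symmetric])
      also have "B * V = S"
        unfolding BSU assoc_mult_mat[OF S U V(1)] V(2) using S by simp
      finally show ?thesis .
    qed
    ultimately show "\<exists>y \<in> carrier_vec n. z = B *\<^sub>v y"
      using V x by (intro bexI[of _ "V *\<^sub>v x"]) auto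
  qed
qed

lemma nilpotent_mat_eigenvalue_0:
  fixes B :: "'a::field mat"
  assumes "nilpotent_mat n B" and v: "v \<in> carrier_vec n" "v \<noteq> 0\<^sub>v n" and Bv: "B *\<^sub>v v = x \<cdot>\<^sub>v v"
  shows "x = 0"
proof -
  obtain k where B: "B \<in> carrier_mat n n" and k: "B ^\<^sub>m k = 0\<^sub>m n n"
    using assms(1) by (auto simp: nilpotent_mat_def)
  have "eigenvector B v x" using B v Bv by (simp add: eigenvector_def)
  from eigenvector_pow[OF B this, of k] have "x ^ k \<cdot>\<^sub>v v = 0\<^sub>m n n *\<^sub>v v" by (simp add: k)
  also have "\<dots> = 0\<^sub>v n" using v(1) by auto
  finally have "x ^ k \<cdot>\<^sub>v v = 0\<^sub>v n" .
  moreover obtain i where i: "i < n" "v $ i \<noteq> 0"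
    using v by (metis carrier_vecD eq_vecI index_zero_vec)
  ultimately have "x ^ k * v $ i = 0"
    using v(1) by (metis carrier_vecD index_smult_vec(1) index_zero_vec(1))
  with i show ?thesis by simp
qed

text \<open>Up to the Toeplitz part, whose first nonzero diagonal is the \<open>m\<close>-th with entry \<open>p m\<close>, such a \<open>B\<close>
  is given by its corner entries \<open>\<gamma>\<close> and \<open>\<delta>\<close>. The kernel vector \<open>z = (\<gamma> / p m) e\<^sub>m - e\<^sub>N\<close> is in the
  image only if \<open>N - 1 = 2 m\<close> and \<open>\<gamma> \<delta> = - (p m)^2\<close>, and this forces \<open>B\<^sup>2 = 0\<close>.\<close>

lemma square_zero_if_commutes_hook:
  fixes B :: "'a::field mat"
  assumes N: "3 \<le> N" and nil: "nilpotent_mat (Suc N) B"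
    and comm: "jordan_matrix [(N, 0), (1, 0)] * B = B * jordan_matrix [(N, 0), (1, 0)]"
    and ker: "kernel_in_image (Suc N) B"
  shows "B * B = 0\<^sub>m (Suc N) (Suc N)"
proof -
  define n where "n = Suc N"
  have nN: "N < n" "n = N + 1" by (simp_all add: n_def)
  have nil: "nilpotent_mat n B" and ker: "kernel_in_image n B" using nil ker by (simp_all add: n_def)
  have B: "B \<in> carrier_mat n n" using nil by (simp add: nilpotent_mat_def)
  define J :: "'a mat" where "J = jordan_matrix [(N, 0), (1, 0)]"
  have J: "J \<in> carrier_mat n n"
    using jordan_matrix_carrier[of "[(N, 0), (1, 0 :: 'a)]"] by (simp add: n_def J_def)
  have Ji: "J $$ (i, c) = (if c = Suc i \<and> c \<noteq> N then 1 else 0)" if "i < n" "c < n" for i c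
    unfolding J_def using that by (intro jordan_matrix_two_blocks_index) (auto simp: n_def)
  have comm: "J * B = B * J" using comm by (simp only: J_def)
  \<comment> \<open>Both sides are the entry (i, c) of \<open>J * B = B * J\<close>; the exceptions
    at \<open>N\<close> come from the break between the blocks.\<close>
  have shift: "(if Suc i < n \<and> Suc i \<noteq> N then B $$ (Suc i, c) else 0) =
      (if c \<noteq> 0 \<and> c \<noteq> N then B $$ (i, c - 1) else 0)" if i: "i < n" and c: "c < n" for i c
  proof -
    have "(J * B) $$ (i, c) = (\<Sum>k<n. if k = Suc i then if Suc i \<noteq> N then B $$ (k, c) else 0 else 0)"
      unfolding index_mult_mat_sum[OF J B i c]
      by (rule sum.cong) (use i c in \<open>auto simp: Ji\<close>)
    also have "\<dots> = (if Suc i < n \<and> Suc i \<noteq> N then B $$ (Suc i, c) else 0)" by simp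
    finally have 1: "(J * B) $$ (i, c) = (if Suc i < n \<and> Suc i \<noteq> N then B $$ (Suc i, c) else 0)" .
    have "(B * J) $$ (i, c) = (\<Sum>k<n. if k = c - 1 then if c \<noteq> 0 \<and> c \<noteq> N then B $$ (i, k) else 0 else 0)"
      unfolding index_mult_mat_sum[OF B J i c]
      by (rule sum.cong) (use i c in \<open>auto simp: Ji\<close>)
    also have "\<dots> = (if c \<noteq> 0 \<and> c \<noteq> N then B $$ (i, c - 1) else 0)" using c by auto
    finally show ?thesis using 1 comm by simp
  qed
  define p where "p k = B $$ (0, k)" for k
  define \<gamma> where "\<gamma> = B $$ (0, N)"
  define \<delta> where "\<delta> = B $$ (N, N - 1)"
  have Bp: "B $$ (i, c) = (if i \<le> c then p (c - i) else 0)" if "i < N" "c < N" for i c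
    unfolding p_def
  proof (rule toeplitz_if_shift[OF _ that])
    fix i c assume "Suc i < N" "c < N"
    then show "B $$ (Suc i, c) = (if c = 0 then 0 else B $$ (i, c - 1))"
      using shift[of i c] by (simp add: n_def)
  qed
  \<comment> \<open>In \<open>shift\<close> the right side is 0 for \<open>c = N\<close> and the
    left side is 0 for \<open>i = N\<close>. So column \<open>N\<close> keeps only
    \<open>\<gamma>\<close> at the top and row \<open>N\<close> only \<open>\<delta>\<close> at
    place \<open>N - 1\<close>, apart from their common entry.\<close>
  have BcN: "B $$ (i, N) = (if i = 0 then \<gamma> else 0)" if "i < N" for i
    using shift[of "i - 1" N] that by (cases i) (simp_all add: \<gamma>_def n_def)
  have BNc: "B $$ (N, c) = (if c = N - 1 then \<delta> else 0)" if "c < N" for c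
  proof (cases "Suc c = N")
    case True
    then have "c = N - 1" by simp
    then show ?thesis by (simp add: \<delta>_def)
  next
    case False
    then show ?thesis using shift[of N "Suc c"] that by (simp add: n_def del: index_mult_mat split: if_splits)
  qed
  have unit0: "unit_vec n i \<noteq> (0\<^sub>v n :: 'a vec)" if "i < n" for i
    using that by simp
  have p0: "p 0 = 0"
  proof (rule nilpotent_mat_eigenvalue_0[OF nil])
    show "B *\<^sub>v unit_vec n 0 = p 0 \<cdot>\<^sub>v unit_vec n 0"
      unfolding mult_mat_vec_unit_vec[OF B, of 0, OF zero_less_Suc[of N, folded n_def]]
    proof (rule eq_vecI)
      fix i assume "i < dim_vec (p 0 \<cdot>\<^sub>v (unit_vec n 0 :: 'a vec))"
      then have i: "i < n" by simp
      then consider "i < N" | "i = N" unfolding n_def by linarith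
      then show "col B 0 $ i = (p 0 \<cdot>\<^sub>v unit_vec n 0) $ i"
        using i N B by cases (auto simp: Bp BNc nN)
    qed (use B in simp)
  qed (use unit0[of 0] nN in simp_all)
  have BNN: "B $$ (N, N) = 0"
  proof (rule ccontr)
    assume s: "B $$ (N, N) \<noteq> 0"
    \<comment> \<open>Column \<open>N\<close> is a combination of \<open>e_0\<close> and
      \<open>e_N\<close>. As \<open>B\<close> kills \<open>e_0\<close>, it is an eigenvector for the
      eigenvalue \<open>B $$ (N, N)\<close>.\<close>
    define x where "x = vec n (\<lambda>i. B $$ (i, N))"
    have x: "x \<in> carrier_vec n" by (simp add: x_def)
    have "B *\<^sub>v x = B $$ (N, N) \<cdot>\<^sub>v x"
    proof (rule eq_vecI)
      fix i assume "i < dim_vec (B $$ (N, N) \<cdot>\<^sub>v x)"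
      then have i: "i < n" using x by simp
      have "B $$ (i, 0) = 0" using i N p0 by (cases "i < N") (auto simp: Bp BNc n_def less_Suc_eq)
      then have "(B *\<^sub>v x) $ i = (\<Sum>k<n. if k = N then B $$ (i, N) * B $$ (N, N) else 0)"
        unfolding index_mult_mat_vec_sum[OF B x i]
        by (intro sum.cong) (auto simp: x_def BcN n_def less_Suc_eq split: if_splits)
      then show "(B *\<^sub>v x) $ i = (B $$ (N, N) \<cdot>\<^sub>v x) $ i"
        using i nN by (simp add: x_def)
    qed (use B x in simp)
    moreover have "x $ N = B $$ (N, N)" using nN(1) by (simp add: x_def)
    with s nN(1) have "x \<noteq> 0\<^sub>v n" by auto
    ultimately show False using nilpotent_mat_eigenvalue_0[OF nil x] s by blast
  qed
  have sumn: "(\<Sum>k<n. f k) = (\<Sum>k<N. f k) + f N" for f :: "nat \<Rightarrow> 'a"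
    by (simp add: n_def)
  \<comment> \<open>Otherwise column 1 and row 1 of \<open>B\<close> both vanish, because
    \<open>1 < N - 1\<close>, so \<open>e_1\<close> lies in the kernel but not in the image.\<close>
  have "\<exists>k < N - 1. p k \<noteq> 0"
  proof (rule ccontr)
    assume "\<not> ?thesis"
    then have pz: "p k = 0" if "k < N - 1" for k using that by blast
    have "B *\<^sub>v unit_vec n 1 = 0\<^sub>v n"
      using B N mult_mat_vec_unit_vec[OF B, of 1]
      by (intro eq_vecI) (auto simp: n_def less_Suc_eq Bp BNc pz)
    then obtain y where y: "y \<in> carrier_vec n" "unit_vec n 1 = B *\<^sub>v y"
      using ker unit_vec_carrier unfolding kernel_in_image_def by metis
    have "(B *\<^sub>v y) $ 1 = (\<Sum>k<n. B $$ (1, k) * y $ k)"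
      by (rule index_mult_mat_vec_sum[OF B y(1)]) (use N in \<open>simp add: n_def\<close>)
    also have "\<dots> = 0"
      by (rule sum.neutral) (use N in \<open>auto simp: n_def less_Suc_eq Bp BcN pz\<close>)
    finally show False unfolding y(2)[symmetric] using N by (simp add: n_def)
  qed
  then obtain k0 where k0: "k0 < N - 1" "p k0 \<noteq> 0" by blast
  define m where "m = (LEAST k. p k \<noteq> 0)"
  have pm: "p m \<noteq> 0" unfolding m_def by (rule LeastI) (rule k0)
  have pl: "p k = 0" if "k < m" for k using not_less_Least that unfolding m_def by blast
  have mN: "m < N - 1" using Least_le[of "\<lambda>k. p k \<noteq> 0", OF k0(2)] k0(1) unfolding m_def by simp
  have mN': "m < N" "N \<noteq> m" using mN by simp_all
  define z where "z = vec n (\<lambda>i. if i = m then \<gamma> / p m else if i = N then - 1 else 0)"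
  have z: "z \<in> carrier_vec n" by (simp add: z_def)
  have "B *\<^sub>v z = 0\<^sub>v n"
  \<comment> \<open>As \<open>m\<close> is minimal and below \<open>N - 1\<close>, column
    \<open>m\<close> of \<open>B\<close> is \<open>p m\<close> times \<open>e_0\<close>, and column
    \<open>N\<close> is \<open>\<gamma>\<close> times \<open>e_0\<close>; the coefficients of
    \<open>z\<close> cancel them.\<close>
  proof (rule eq_vecI)
    fix i assume "i < dim_vec (0\<^sub>v n :: 'a vec)"
    then have i: "i < n" by simp
    have "(B *\<^sub>v z) $ i = (\<Sum>k<n. B $$ (i, k) * z $ k)" by (rule index_mult_mat_vec_sum[OF B z i])
    also have "\<dots> = (\<Sum>k\<in>{m, N}. B $$ (i, k) * z $ k)"
      by (rule sum.mono_neutral_right) (use mN mN' nN in \<open>auto simp: z_def\<close>)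
    also have "\<dots> = B $$ (i, m) * (\<gamma> / p m) - B $$ (i, N)"
      using mN mN' nN by (simp add: z_def)
    also have "\<dots> = 0"
    proof (cases "i < N")
      case True
      then show ?thesis using mN pm pl by (cases "i = 0") (auto simp: Bp BcN)
    next
      case False
      then have "i = N" using i by (simp add: n_def)
      then show ?thesis using mN by (simp add: BNc BNN)
    qed
    finally show "(B *\<^sub>v z) $ i = 0\<^sub>v n $ i" using i by simp
  qed (use B in simp)
  then obtain y where y: "y \<in> carrier_vec n" "z = B *\<^sub>v y"
    using ker z unfolding kernel_in_image_def by blast
  have zi: "z $ i = (\<Sum>k<n. B $$ (i, k) * y $ k)" if "i < n" for i
    unfolding y(2) by (rule index_mult_mat_vec_sum[OF B y(1) that])
  have "z $ N = \<delta> * y $ (N - 1)"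
  proof -
    have "(\<Sum>k<N. B $$ (N, k) * y $ k) = (\<Sum>k<N. if k = N - 1 then \<delta> * y $ k else 0)"
      by (rule sum.cong) (auto simp: BNc)
    then show ?thesis using N unfolding zi[OF nN(1)] sumn by (simp add: BNN)
  qed
  then have dy: "\<delta> * y $ (N - 1) = - 1" using mN mN' nN by (simp add: z_def)
  \<comment> \<open>The only nonzero entry of row \<open>r\<close> is \<open>p m\<close>, in column
    \<open>N - 1\<close>. So \<open>z $ r\<close> is nonzero, and by the support of \<open>z\<close>
    this leaves only \<open>r = m\<close>.\<close>
  define r where "r = N - 1 - m"
  have r: "0 < r" "r < N" using mN N by (auto simp: r_def)
  have "z $ r = p m * y $ (N - 1)"
  proof -
    have "(\<Sum>k<N. B $$ (r, k) * y $ k) = (\<Sum>k<N. if k = N - 1 then p m * y $ k else 0)"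
      by (rule sum.cong) (use r mN in \<open>auto simp: Bp pl r_def\<close>)
    then show ?thesis using N r zi[of r] nN unfolding sumn by (simp add: BcN)
  qed
  moreover have "y $ (N - 1) \<noteq> 0" using dy by auto
  ultimately have zr: "z $ r \<noteq> 0" using pm by simp
  then have rm: "r = m" using r nN by (auto simp: z_def split: if_splits)
  then have N2: "N - 1 = 2 * m" using r by (simp add: r_def)
  have "\<gamma> / p m = p m * y $ (N - 1)"
    using \<open>z $ r = p m * y $ (N - 1)\<close> mN mN' nN by (simp add: rm z_def)
  then have "\<gamma> = p m * p m * y $ (N - 1)" using pm by (simp add: field_simps)
  then have "\<gamma> * \<delta> = p m * p m * (\<delta> * y $ (N - 1))" by simp
  then have gd: "p m * p m + \<gamma> * \<delta> = 0" unfolding dy by simp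
  have "B * B = 0\<^sub>m n n"
  proof (rule eq_matI)
    fix i c assume "i < dim_row (0\<^sub>m n n)" "c < dim_col (0\<^sub>m n n)"
    then have i: "i < n" and c: "c < n" by auto
    have BB: "(B * B) $$ (i, c) = (\<Sum>k<N. B $$ (i, k) * B $$ (k, c)) + B $$ (i, N) * B $$ (N, c)"
      unfolding index_mult_mat_sum[OF B B i c] sumn ..
    \<comment> \<open>Only the entry (0, N - 1) can receive anything: \<open>p m * p m\<close> from
      the Toeplitz part and \<open>\<gamma> * \<delta>\<close> from the corners, which cancel.
      Elsewhere in the Toeplitz part the offsets add up to less than \<open>2 * m\<close>.\<close>
    consider "i < N" "c < N" "i = 0" "c = N - 1" | "i < N" "c < N" "i \<noteq> 0 \<or> c \<noteq> N - 1"
      | "i < N" "c = N" | "i = N" "c < N" | "i = N" "c = N"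
      using i c unfolding n_def by linarith
    then have "(\<Sum>k<N. B $$ (i, k) * B $$ (k, c)) + B $$ (i, N) * B $$ (N, c) = 0"
    proof cases
      case 1
      have "(\<Sum>k<N. B $$ (i, k) * B $$ (k, c)) = (\<Sum>k<N. if k = m then p m * p m else 0)"
      proof (rule sum.cong)
        fix k assume "k \<in> {..<N}"
        then have k: "k < N" "k \<le> N - 1" by auto
        have e: "B $$ (i, k) * B $$ (k, c) = p k * p (N - 1 - k)"
          unfolding 1(3,4) using k 1(2,4) by (simp add: Bp)
        consider "k < m" | "k = m" "N - 1 - k = m" | "k \<noteq> m" "N - 1 - k < m" using N2 N by linarith
        then show "B $$ (i, k) * B $$ (k, c) = (if k = m then p m * p m else 0)"
          unfolding e by cases (simp_all add: pl)
      qed simp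
      then show ?thesis using 1 gd mN by (simp add: BcN BNc)
    next
      case 2
      have "B $$ (i, k) * B $$ (k, c) = 0" if "k < N" for k
      proof (cases "k - i < m")
        case True
        then show ?thesis using 2 that by (simp add: Bp pl)
      next
        case False
        then have "c - k < m \<or> c < k" using 2 that N2 by linarith
        then show ?thesis using 2 that by (auto simp: Bp pl)
      qed
      then have "(\<Sum>k<N. B $$ (i, k) * B $$ (k, c)) = 0" by (intro sum.neutral) auto
      then show ?thesis using 2 by (auto simp: BcN BNc)
    next
      case 3
      have "B $$ (i, k) * B $$ (k, c) = 0" if "k < N" for k
        using 3 that p0 by (auto simp: Bp BcN)
      then have "(\<Sum>k<N. B $$ (i, k) * B $$ (k, c)) = 0" by (intro sum.neutral) auto
      then show ?thesis using 3 by (simp add: BNN)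
    next
      case 4
      have "B $$ (i, k) * B $$ (k, c) = 0" if "k < N" for k
        using 4 that p0 by (auto simp: Bp BNc)
      then have "(\<Sum>k<N. B $$ (i, k) * B $$ (k, c)) = 0" by (intro sum.neutral) auto
      then show ?thesis using 4 by (simp add: BNN)
    next
      case 5
      have "B $$ (i, k) * B $$ (k, c) = 0" if "k < N" for k
        using 5 that N by (auto simp: BcN BNc)
      then have "(\<Sum>k<N. B $$ (i, k) * B $$ (k, c)) = 0" by (intro sum.neutral) auto
      then show ?thesis using 5 by (simp add: BNN)
    qed
    then show "(B * B) $$ (i, c) = 0\<^sub>m n n $$ (i, c)" using BB i c by simp
  qed (use B in auto)
  then show ?thesis by (simp add: n_def)
qed

section \<open>Necessity of the square-zero condition and the small cases\<close>

lemma shape_commutes_with_jordan_matrix: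
  fixes B :: "'a::field mat"
  assumes B: "B \<in> carrier_mat n n" and xs: "mset xs \<in> shapes_of_commuting_nilpotents n B"
  defines "J \<equiv> jordan_matrix (map (\<lambda>m. (m, 0)) xs)"
  obtains B' where "B' \<in> carrier_mat n n" "similar_mat B B'" "J * B' = B' * J"
proof -
  obtain A where A: "nilpotent_mat n A" "A * B = B * A" "is_shape A (mset xs)"
    using xs by (auto simp: shapes_of_commuting_nilpotents_def commuting_nilpotents_def)
  then have Ac: "A \<in> carrier_mat n n" by (simp add: nilpotent_mat_def)
  have "nil_shape A (mset xs)" using A is_shape_iff_nil_shape by blast
  from nil_shape_jordan_nf[OF this] have "similar_mat A J" by (simp add: jordan_nf_def J_def)
  from commuting_transfer[OF Ac B A(2) this] that show thesis by blast
qed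

text \<open>The shapes (n) and (n - 1, 1) lead to different matrices \<open>B1\<close> and
  \<open>B'\<close> similar to \<open>B\<close>. The first gives \<open>kernel_in_image\<close> for
  \<open>B1\<close>, which similarity carries through \<open>B\<close> to \<open>B'\<close>, where
  the second gives a contradiction.\<close>

lemma square_zero_if_all_shapes:
  fixes B :: "'a::field mat"
  assumes nil: "nilpotent_mat n B" and n: "4 \<le> n"
    and all: "shapes_of_commuting_nilpotents n B = partitions n"
  shows "B * B = 0\<^sub>m n n"
proof (rule ccontr)
  assume B2: "B * B \<noteq> 0\<^sub>m n n"
  have B: "B \<in> carrier_mat n n" using nil by (simp add: nilpotent_mat_def)
  have sq: "X ^\<^sub>m 2 = X * X" if "X \<in> carrier_mat n n" for X :: "'a mat"
    using that by (simp add: numeral_2_eq_2)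
  have "mset [n] \<in> shapes_of_commuting_nilpotents n B"
    unfolding all using n by (simp add: partitions_def)
  then obtain B1 where B1: "B1 \<in> carrier_mat n n" "similar_mat B B1"
    "jordan_matrix [(n, 0)] * B1 = B1 * jordan_matrix [(n, 0)]"
    using shape_commutes_with_jordan_matrix[OF B, of "[n]"] by auto
  have "B1 * B1 \<noteq> 0\<^sub>m n n"
    using similar_mat_pow_eq_0[OF similar_mat_sym[OF B1(2)] B1(1), of 2] B2 B B1(1) by (auto simp: sq)
  moreover have "jordan_matrix [(n, 0 :: 'a)] = jordan_block n 0"
    by (simp add: jordan_matrix_def del: diag_block_mat.simps)
  ultimately have "kernel_in_image n B1"
    using kernel_in_image_if_commutes_jordan_block[OF B1(1)] B1(3) by simp
  with kernel_in_image_similar[OF B B1(2)] have ker: "kernel_in_image n B" .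
  have "mset [n - 1, 1] \<in> shapes_of_commuting_nilpotents n B"
    unfolding all using n by (simp add: partitions_def)
  then obtain B' where B': "B' \<in> carrier_mat n n" "similar_mat B B'"
    "jordan_matrix [(n - 1, 0), (1, 0)] * B' = B' * jordan_matrix [(n - 1, 0), (1, 0)]"
    using shape_commutes_with_jordan_matrix[OF B, of "[n - 1, 1]"] by auto
  have "nilpotent_mat n B'" by (rule nilpotent_mat_similar[OF nil B'(2)])
  moreover have "kernel_in_image n B'"
    by (rule kernel_in_image_similar[OF B'(1) similar_mat_sym[OF B'(2)] ker])
  moreover have "Suc (n - 1) = n" using n by simp
  ultimately have "B' * B' = 0\<^sub>m n n"
    using square_zero_if_commutes_hook[of "n - 1" B'] B'(3) n by simp
  then have "B * B = 0\<^sub>m n n"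
    using similar_mat_pow_eq_0[OF similar_mat_sym[OF B'(2)] B'(1), of 2] B B'(1) by (auto simp: sq)
  with B2 show False ..
qed

text \<open>For the shape (3) the matrix \<open>B\<close> itself serves. All other partitions of 3
  have parts at most 2, and \<open>commuting_shapes_single\<close> with \<open>a = 3\<close> applies
  with the roles exchanged.\<close>

lemma shapes_regular_3:
  fixes B :: "'a::field mat"
  assumes B: "B \<in> carrier_mat 3 3" and q: "nil_shape B {#3#}"
  shows "shapes_of_commuting_nilpotents 3 B = partitions 3"
proof (rule antisym[OF shapes_subset_partitions], rule subsetI)
  fix p :: "nat multiset" assume p: "p \<in> partitions 3"
  have "commuting_shapes TYPE('a) p {#3#}"
  proof (cases "3 \<in># p")
    case True
    with p have "p = {#3#}" by (rule partition_eq_single)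
    then show ?thesis using commuting_shapesI[OF B B refl q q] by simp
  next
    case False
    have "m \<le> 2" if m: "m \<in># p" for m
    proof -
      have "m \<noteq> 3" using False m by metis
      with partition_part_le[OF p m] show ?thesis by linarith
    qed
    then have "\<forall>m \<in># p. m \<le> 2" by blast
    then obtain k where "2 * k \<le> 3" and kl: "p = replicate_mset k 2 + replicate_mset (3 - 2 * k) 1"
      by (rule partition_parts_le_2[OF p])
    with commuting_shapes_sym[OF commuting_shapes_single[of k 3, where 'a = 'a]] kl show ?thesis
      by simp
  qed
  then show "p \<in> shapes_of_commuting_nilpotents 3 B" by (rule commuting_shapes_imp_shape[OF B q])
qed

theorem theorem2p4:
  fixes B :: "'a::{alg_closed_field, field_char_0} mat" and n :: nat
  assumes "nilpotent_mat n B"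
  shows "(n \<le> 3 \<longrightarrow> shapes_of_commuting_nilpotents n B = partitions n) \<and>
         (n \<ge> 4 \<longrightarrow> (shapes_of_commuting_nilpotents n B = partitions n \<longleftrightarrow> B * B = 0\<^sub>m n n))"
proof -
  have B: "B \<in> carrier_mat n n" using assms by (simp add: nilpotent_mat_def)
  \<comment> \<open>For \<open>n \<le> 3\<close> the square-zero case is settled by
    \<open>shapes_if_square_zero\<close>. Otherwise some part exceeds 2, which leaves only
    \<open>n = 3\<close> and the shape (3).\<close>
  have "shapes_of_commuting_nilpotents n B = partitions n" if n: "n \<le> 3" "B * B \<noteq> 0\<^sub>m n n"
  proof -
    obtain q where q: "nil_shape B q" using nil_shape_exists[OF assms] by blast
    have "B ^\<^sub>m 2 \<noteq> 0\<^sub>m n n" using B n(2) by (simp add: numeral_2_eq_2)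
    with nil_shape_pow_eq_0_iff[OF q B] obtain m where m: "m \<in># q" "2 < m" by force
    obtain q' where q': "q = add_mset m q'" using m(1) by (metis mset_add)
    have part: "q \<in> partitions n" by (rule nil_shape_partition[OF q B])
    then have "m + sum_mset q' = n" by (simp add: partitions_def q')
    with m(2) n(1) have "n = 3" "m = 3" by linarith+
    with partition_eq_single[OF part] m(1) have "q = {#3#}" by simp
    with shapes_regular_3 B q \<open>n = 3\<close> show ?thesis by blast
  qed
  with shapes_if_square_zero[OF B] square_zero_if_all_shapes[OF assms] show ?thesis by blast
qed

end
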